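(* Let $(M_1^{n_1},g_1)$ be a compact Riemannian manifold, $(M_2^{n_2},F_2)$ a weakly Berwald Finsler manifold, $n_1,n_2\ge2$, and $f$ a positive smooth function on $M_1$, such that the Finsler warped product $M=M_1\times_f M_2$ is Einstein with positive Ricci scalar function. If the warped product $M$ is nontrivial, then the Ricci scalar function of the fiber $M_2$ is positive.
   Context: Manifolds are connected. A Finsler metric on a smooth manifold $M$ is a continuous $F:TM\to[0,\infty)$, smooth on $TM^0=TM\setminus\{0\}$, positively 1-homogeneous on fibers, with $g_{ij}=\frac12\frac{\partial^2F^2}{\partial y^i\partial y^j}$ positive definite on $TM^0$. Spray coefficients: $G^i=\frac14 g^{i\ell}\{[F^2]_{x^ky^\ell}y^k-[F^2]_{x^\ell}\}$. $(M,F)$ is weakly Berwald if $E_{ij}=\frac12\frac{\partial^2}{\partial y^i\partial y^j}\big(\frac{\partial G^s}{\partial y^s}\big)$ vanishes identically. Riemann curvature: $R^i_k=2\frac{\partial G^i}{\partial x^k}-y^j\frac{\partial^2G^i}{\partial x^j\partial y^k}+2G^j\frac{\partial^2G^i}{\partial y^j\partial y^k}-\frac{\partial G^i}{\partial y^j}\frac{\partial G^j}{\partial y^k}$; Ricci curvature: $\operatorname{Ric}=\sum_i R^i_i$, and $\operatorname{Ric}_{ij}=\frac12\frac{\partial^2\operatorname{Ric}}{\partial y^i\partial y^j}$. $(M,F)$ is Einstein with Ricci scalar $\lambda$ if $\operatorname{Ric}(x,y)=\lambda(x)F^2(x,y)$, i.e. $\operatorname{Ric}_{ij}=\lambda g_{ij}$,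 for a function $\lambda=\lambda(x)$ on $M$. The Finsler warped product $M=M_1\times_f M_2$ of a base $(M_1,F_1)$ and fiber $(M_2,F_2)$ with warping function $f>0$ smooth on $M_1$ is $M_1\times M_2$ with $F^2(x_1,y_1,x_2,y_2)=F_1^2(x_1,y_1)+f^2(x_1)F_2^2(x_2,y_2)$ on $TM_1^0\times TM_2^0$, with geometric quantities computed there. It is trivial if $f$ is constant, nontrivial otherwise. When the base is Riemannian, the fiber weakly Berwald and $M$ Einstein, the fiber is Einstein; its Ricci scalar function is the function $\mu$ on $M_2$ with $\operatorname{Ric}^{M_2}_{\alpha\beta}=\mu g_{\alpha\beta}$. *)

theory Defs
  imports "HOL-Analysis.Analysis"
begin

section \<open>Smooth manifolds\<close>

text \<open>Differentiability of class \<open>C\<^sup>k\<close>. Only meaningful on open sets, and only used there.\<close>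

primrec Ck_on :: "nat \<Rightarrow> ('e::real_normed_vector \<Rightarrow> 'f::real_normed_vector) \<Rightarrow> 'e set \<Rightarrow> bool" where
  "Ck_on 0 h S \<longleftrightarrow> continuous_on S h"
| "Ck_on (Suc k) h S \<longleftrightarrow>
     (\<forall>x\<in>S. h differentiable (at x)) \<and> (\<forall>v. Ck_on k (\<lambda>x. frechet_derivative h (at x) v) S)"

definition smooth_on :: "('e::real_normed_vector \<Rightarrow> 'f::real_normed_vector) \<Rightarrow> 'e set \<Rightarrow> bool" where
  "smooth_on h S \<longleftrightarrow> (\<forall>k. Ck_on k h S)"

text \<open>A chart is its domain together with a coordinate map, whose values outside the domain are
  irrelevant. The atlas of a manifold need not be maximal.\<close>

type_synonym ('a, 'n) chart = "'a set \<times> ('a \<Rightarrow> real^'n)"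

record ('a, 'n::finite) mfd =
  mtop :: "'a topology"
  atlas :: "('a, 'n) chart set"

definition chart_image :: "('a, 'n::finite) chart \<Rightarrow> (real^'n) set" where
  "chart_image c = snd c ` fst c"

definition chart_inv :: "('a, 'n::finite) chart \<Rightarrow> real^'n \<Rightarrow> 'a" where
  "chart_inv c = inv_into (fst c) (snd c)"

definition charts_at :: "('a, 'n::finite) mfd \<Rightarrow> 'a \<Rightarrow> ('a, 'n) chart set" where
  "charts_at M p = {c \<in> atlas M. p \<in> fst c}"

definition transition :: "('a, 'n::finite) chart \<Rightarrow> ('a, 'n) chart \<Rightarrow> real^'n \<Rightarrow> real^'n" where
  "transition c d = snd d \<circ> chart_inv c"

definition smooth_manifold :: "('a, 'n::finite) mfd \<Rightarrow> bool" where
  "smooth_manifold M \<longleftrightarrow>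
     connected_space (mtop M) \<and> Hausdorff_space (mtop M) \<and> second_countable (mtop M) \<and>
     (\<forall>p\<in>topspace (mtop M). charts_at M p \<noteq> {}) \<and>
     (\<forall>c\<in>atlas M. openin (mtop M) (fst c) \<and> open (chart_image c) \<and>
        homeomorphic_map (subtopology (mtop M) (fst c)) (top_of_set (chart_image c)) (snd c)) \<and>
     (\<forall>c\<in>atlas M. \<forall>d\<in>atlas M. smooth_on (transition c d) (snd c ` (fst c \<inter> fst d)))"

definition smooth_function :: "('a, 'n::finite) mfd \<Rightarrow> ('a \<Rightarrow> real) \<Rightarrow> bool" where
  "smooth_function M f \<longleftrightarrow> (\<forall>c\<in>atlas M. smooth_on (f \<circ> chart_inv c) (chart_image c))"

section \<open>Tangent bundle\<close>

text \<open>A tangent vector at \<open>p\<close> is given by its coordinate vectors with respect to all charts around \<open>p\<close>,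
  related by the differentials of the transition maps (and set to \<open>0\<close> at the other charts, so that
  equality of tangent vectors is equality of functions).\<close>

type_synonym ('a, 'n) tvec = "'a \<times> (('a, 'n) chart \<Rightarrow> real^'n)"

definition tangent_bundle :: "('a, 'n::finite) mfd \<Rightarrow> ('a, 'n) tvec set" where
  "tangent_bundle M = {(p, v). p \<in> topspace (mtop M) \<and>
     (\<forall>c\<in>charts_at M p. \<forall>d\<in>charts_at M p.
        v d = frechet_derivative (transition c d) (at (snd c p)) (v c)) \<and>
     (\<forall>c. c \<notin> charts_at M p \<longrightarrow> v c = 0)}"

definition slit_tangent_bundle :: "('a, 'n::finite) mfd \<Rightarrow> ('a, 'n) tvec set" where
  "slit_tangent_bundle M = {V \<in> tangent_bundle M. snd V \<noteq> (\<lambda>c. 0)}"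

text \<open>The tangent vector with coordinates \<open>(x, y)\<close> in the chart of the tangent bundle induced by \<open>c\<close>.\<close>

definition tangent_of ::
    "('a, 'n::finite) mfd \<Rightarrow> ('a, 'n) chart \<Rightarrow> real^'n \<Rightarrow> real^'n \<Rightarrow> ('a, 'n) tvec" where
  "tangent_of M c x y =
     (chart_inv c x,
      \<lambda>d. if d \<in> charts_at M (chart_inv c x) then frechet_derivative (transition c d) (at x) y else 0)"

text \<open>The differential of a smooth map; the chosen chart \<open>c\<close> does not matter.\<close>

definition tangent_map ::
    "('a, 'm::finite) mfd \<Rightarrow> ('b, 'n::finite) mfd \<Rightarrow> ('a \<Rightarrow> 'b) \<Rightarrow> ('a, 'm) tvec \<Rightarrow> ('b, 'n) tvec" where
  "tangent_map M N h V =
     (let p = fst V; c = (SOME c. c \<in> charts_at M p) in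
      (h p,
       \<lambda>d. if d \<in> charts_at N (h p)
           then frechet_derivative (snd d \<circ> h \<circ> chart_inv c) (at (snd c p)) (snd V c) else 0))"

definition local_rep ::
    "('a, 'n::finite) mfd \<Rightarrow> (('a, 'n) tvec \<Rightarrow> real) \<Rightarrow> ('a, 'n) chart \<Rightarrow> real^'n \<Rightarrow> real^'n \<Rightarrow> real" where
  "local_rep M F c x y = F (tangent_of M c x y)"

section \<open>Geometric quantities in local coordinates\<close>

text \<open>Partial derivatives of \<open>h(x, y)\<close> with respect to \<open>x\<^sup>i\<close> and \<open>y\<^sup>i\<close>. Below, \<open>L\<close> is the coordinate
  expression of a Finsler metric.\<close>

definition dx :: "'n::finite \<Rightarrow> (real^'n \<Rightarrow> real^'n \<Rightarrow> real) \<Rightarrow> real^'n \<Rightarrow> real^'n \<Rightarrow> real" where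
  "dx i h x y = frechet_derivative (\<lambda>x. h x y) (at x) (axis i 1)"

definition dy :: "'n::finite \<Rightarrow> (real^'n \<Rightarrow> real^'n \<Rightarrow> real) \<Rightarrow> real^'n \<Rightarrow> real^'n \<Rightarrow> real" where
  "dy i h x y = frechet_derivative (\<lambda>y. h x y) (at y) (axis i 1)"

definition fundamental_tensor ::
    "(real^'n \<Rightarrow> real^'n \<Rightarrow> real) \<Rightarrow> 'n::finite \<Rightarrow> 'n \<Rightarrow> real^'n \<Rightarrow> real^'n \<Rightarrow> real" where
  "fundamental_tensor L i j x y = 1/2 * dy i (dy j (\<lambda>x y. (L x y)\<^sup>2)) x y"

definition inverse_tensor ::
    "(real^'n \<Rightarrow> real^'n \<Rightarrow> real) \<Rightarrow> 'n::finite \<Rightarrow> 'n \<Rightarrow> real^'n \<Rightarrow> real^'n \<Rightarrow> real" where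
  "inverse_tensor L i l x y = matrix_inv (\<chi> i j. fundamental_tensor L i j x y) $ i $ l"

definition spray ::
    "(real^'n \<Rightarrow> real^'n \<Rightarrow> real) \<Rightarrow> 'n::finite \<Rightarrow> real^'n \<Rightarrow> real^'n \<Rightarrow> real" where
  "spray L i x y = 1/4 * (\<Sum>l\<in>UNIV. inverse_tensor L i l x y *
     ((\<Sum>k\<in>UNIV. dx k (dy l (\<lambda>x y. (L x y)\<^sup>2)) x y * y $ k) - dx l (\<lambda>x y. (L x y)\<^sup>2) x y))"

definition E_curvature ::
    "(real^'n \<Rightarrow> real^'n \<Rightarrow> real) \<Rightarrow> 'n::finite \<Rightarrow> 'n \<Rightarrow> real^'n \<Rightarrow> real^'n \<Rightarrow> real" where
  "E_curvature L i j x y = 1/2 * dy i (dy j (\<lambda>x y. \<Sum>s\<in>UNIV. dy s (spray L s) x y)) x y"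

definition riemann_curvature ::
    "(real^'n \<Rightarrow> real^'n \<Rightarrow> real) \<Rightarrow> 'n::finite \<Rightarrow> 'n \<Rightarrow> real^'n \<Rightarrow> real^'n \<Rightarrow> real" where
  "riemann_curvature L i k x y =
     2 * dx k (spray L i) x y
     - (\<Sum>j\<in>UNIV. y $ j * dx j (dy k (spray L i)) x y)
     + 2 * (\<Sum>j\<in>UNIV. spray L j x y * dy j (dy k (spray L i)) x y)
     - (\<Sum>j\<in>UNIV. dy j (spray L i) x y * dy k (spray L j) x y)"

definition Ric :: "(real^'n \<Rightarrow> real^'n::finite \<Rightarrow> real) \<Rightarrow> real^'n \<Rightarrow> real^'n \<Rightarrow> real" where
  "Ric L x y = (\<Sum>i\<in>UNIV. riemann_curvature L i i x y)"

definition Ric_tensor ::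
    "(real^'n \<Rightarrow> real^'n \<Rightarrow> real) \<Rightarrow> 'n::finite \<Rightarrow> 'n \<Rightarrow> real^'n \<Rightarrow> real^'n \<Rightarrow> real" where
  "Ric_tensor L i j x y = 1/2 * dy i (dy j (Ric L)) x y"

section \<open>Finsler and Riemannian metrics\<close>

definition finsler_metric :: "('a, 'n::finite) mfd \<Rightarrow> (('a, 'n) tvec \<Rightarrow> real) \<Rightarrow> bool" where
  "finsler_metric M F \<longleftrightarrow>
     (\<forall>V\<in>tangent_bundle M. F V \<ge> 0) \<and>
     (\<forall>c\<in>atlas M. let L = local_rep M F c in
        continuous_on (chart_image c \<times> UNIV) (\<lambda>(x, y). L x y) \<and>
        smooth_on (\<lambda>(x, y). L x y) (chart_image c \<times> (UNIV - {0})) \<and>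
        (\<forall>x\<in>chart_image c. \<forall>y. \<forall>t>0. L x (t *\<^sub>R y) = t * L x y) \<and>
        (\<forall>x\<in>chart_image c. \<forall>y. y \<noteq> 0 \<longrightarrow>
           (\<forall>v::real^'n. v \<noteq> 0 \<longrightarrow>
              (\<Sum>i\<in>UNIV. \<Sum>j\<in>UNIV. fundamental_tensor L i j x y * v $ i * v $ j) > 0)))"

text \<open>\<open>g V W\<close> is the inner product of tangent vectors with the same base point.\<close>

definition riemannian_metric ::
    "('a, 'n::finite) mfd \<Rightarrow> (('a, 'n) tvec \<Rightarrow> ('a, 'n) tvec \<Rightarrow> real) \<Rightarrow> bool" where
  "riemannian_metric M g \<longleftrightarrow>
     (\<forall>c\<in>atlas M. let B = (\<lambda>x u v. g (tangent_of M c x u) (tangent_of M c x v)) in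
        (\<forall>x\<in>chart_image c.
           bilinear (B x) \<and> (\<forall>u v. B x u v = B x v u) \<and> (\<forall>u. u \<noteq> 0 \<longrightarrow> B x u u > 0)) \<and>
        (\<forall>i j. smooth_on (\<lambda>x. B x (axis i 1) (axis j 1)) (chart_image c)))"

definition metric_norm ::
    "(('a, 'n::finite) tvec \<Rightarrow> ('a, 'n) tvec \<Rightarrow> real) \<Rightarrow> ('a, 'n) tvec \<Rightarrow> real" where
  "metric_norm g V = sqrt (g V V)"

definition weakly_berwald :: "('a, 'n::finite) mfd \<Rightarrow> (('a, 'n) tvec \<Rightarrow> real) \<Rightarrow> bool" where
  "weakly_berwald M F \<longleftrightarrow>
     (\<forall>c\<in>atlas M. \<forall>x\<in>chart_image c. \<forall>y. y \<noteq> 0 \<longrightarrow>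
        (\<forall>i j. E_curvature (local_rep M F c) i j x y = 0))"

text \<open>Einstein with Ricci scalar \<open>lam\<close>, the geometric quantities being considered on a set \<open>D\<close> of
  tangent vectors: the slit tangent bundle of a Finsler manifold, or, for a warped product (whose
  metric is not smooth at vectors tangent to a factor), the product of the slit tangent bundles of
  the factors. The two equations are equivalent.\<close>

definition einstein_on ::
    "('a, 'n::finite) mfd \<Rightarrow> ('a, 'n) tvec set \<Rightarrow> (('a, 'n) tvec \<Rightarrow> real) \<Rightarrow> ('a \<Rightarrow> real) \<Rightarrow> bool" where
  "einstein_on M D F lam \<longleftrightarrow>
     (\<forall>c\<in>atlas M. \<forall>x\<in>chart_image c. \<forall>y. tangent_of M c x y \<in> D \<longrightarrow>
        (let L = local_rep M F c in
         Ric L x y = lam (chart_inv c x) * (L x y)\<^sup>2 \<and>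
         (\<forall>i j. Ric_tensor L i j x y = lam (chart_inv c x) * fundamental_tensor L i j x y)))"

section \<open>Warped products\<close>

definition vec_join :: "real^'m::finite \<Rightarrow> real^'n::finite \<Rightarrow> real^('m + 'n)" where
  "vec_join x y = (\<chi> k. case k of Inl i \<Rightarrow> x $ i | Inr a \<Rightarrow> y $ a)"

definition prod_chart ::
    "('a, 'm::finite) chart \<Rightarrow> ('b, 'n::finite) chart \<Rightarrow> ('a \<times> 'b, 'm + 'n) chart" where
  "prod_chart c d = (fst c \<times> fst d, \<lambda>(p, q). vec_join (snd c p) (snd d q))"

definition prod_mfd ::
    "('a, 'm::finite) mfd \<Rightarrow> ('b, 'n::finite) mfd \<Rightarrow> ('a \<times> 'b, 'm + 'n) mfd" where
  "prod_mfd M N = \<lparr>mtop = prod_topology (mtop M) (mtop N),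
                   atlas = {prod_chart c d | c d. c \<in> atlas M \<and> d \<in> atlas N}\<rparr>"

definition warped_metric ::
    "('a, 'm::finite) mfd \<Rightarrow> (('a, 'm) tvec \<Rightarrow> real) \<Rightarrow> ('b, 'n::finite) mfd \<Rightarrow> (('b, 'n) tvec \<Rightarrow> real) \<Rightarrow>
     ('a \<Rightarrow> real) \<Rightarrow> ('a \<times> 'b, 'm + 'n) tvec \<Rightarrow> real" where
  "warped_metric M1 F1 M2 F2 f V =
     sqrt ((F1 (tangent_map (prod_mfd M1 M2) M1 fst V))\<^sup>2
           + (f (fst (fst V)))\<^sup>2 * (F2 (tangent_map (prod_mfd M1 M2) M2 snd V))\<^sup>2)"

definition warped_domain ::
    "('a, 'm::finite) mfd \<Rightarrow> ('b, 'n::finite) mfd \<Rightarrow> ('a \<times> 'b, 'm + 'n) tvec set" where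
  "warped_domain M1 M2 =
     {V \<in> tangent_bundle (prod_mfd M1 M2).
        tangent_map (prod_mfd M1 M2) M1 fst V \<in> slit_tangent_bundle M1 \<and>
        tangent_map (prod_mfd M1 M2) M2 snd V \<in> slit_tangent_bundle M2}"

definition trivial_warping :: "('a, 'm::finite) mfd \<Rightarrow> ('a \<Rightarrow> real) \<Rightarrow> bool" where
  "trivial_warping M1 f \<longleftrightarrow> (\<exists>k. \<forall>p\<in>topspace (mtop M1). f p = k)"

end

theory Submission
  imports Defs
begin

text \<open>
  In product coordinates the square of the warped product metric is
  \<open>E = E\<^sub>1(x\<^sub>1, y\<^sub>1) + F(x\<^sub>1) E\<^sub>2(x\<^sub>2, y\<^sub>2)\<close> with \<open>F = f\<^sup>2\<close>, and its spray is
  \<open>G\<^sup>a = G\<^sub>1\<^sup>a + v\<^sup>a E\<^sub>2\<close>, \<open>G\<^sup>\<alpha> = G\<^sub>2\<^sup>\<alpha> + \<phi> y\<^sup>\<alpha>\<close>, where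
  \<open>v\<^sup>a = - 1/4 g\<^sub>1\<^sup>a\<^sup>b \<partial>\<^sub>b F\<close> and \<open>\<phi> = dF(y\<^sub>1) / (2 F)\<close>. As \<open>M\<^sub>1\<close> is compact, \<open>F\<close> attains
  its minimum at some \<open>p\<close>, where \<open>v\<close> and \<open>\<phi>\<close> vanish; over \<open>p\<close> the Ricci curvature is a quadratic
  form in \<open>y\<^sub>1\<close> plus \<open>Ric\<^sub>2 - A E\<^sub>2\<close> with \<open>A = 1/2 g\<^sub>1\<^sup>a\<^sup>b \<partial>\<^sub>a \<partial>\<^sub>b F \<ge> 0\<close>. In the Einstein equation
  the part that is 2-homogeneous in \<open>y\<^sub>1\<close> equals a quantity independent of \<open>y\<^sub>1\<close>, so both vanish.
  This leaves \<open>Ric\<^sub>2 = (\<lambda> F + A) E\<^sub>2\<close> over \<open>p\<close>, and \<open>\<lambda> F + A > 0\<close>.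
\<close>

section \<open>Calculus of smooth functions\<close>

text \<open>Of the warping, only position derivatives of \<open>v\<close> and \<open>\<phi>\<close>
  survive over \<open>p\<close>: the divergence of \<open>v\<close> produces \<open>A\<close>, and
  the derivative of \<open>\<phi>\<close> along \<open>y\<^sub>1\<close>, counted once for each
  fiber direction, joins the part quadratic in \<open>y\<^sub>1\<close>. The separation of variables
  works because \<open>\<lambda>\<close> is a function of position and cannot absorb a change of
  \<open>y\<^sub>1\<close>. Everything happens on the slice over one point of the base, so all
  points of the fiber share the same values of \<open>F\<close> and \<open>A\<close>.

  The obstacle is that curvature consists of iterated derivatives, some of them of an inverse
  matrix, taken through charts of the product, while the formulas for the spray hold only where the
  fiber velocity is nonzero. Each identity is therefore proved on a whole open set and carried
  through derivatives by congruence lemmas, with smoothness of every ingredient established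
  beforehand. Since the claim concerns every Ricci scalar of the fiber, the function found has to be
  shown unique as well; this comes from definiteness of the fundamental tensor.\<close>

lemma Ck_on_cong:
  fixes f g :: "'e::real_normed_vector \<Rightarrow> 'f::real_normed_vector"
  assumes "open S" "Ck_on k f S" "\<And>x. x \<in> S \<Longrightarrow> f x = g x"
  shows "Ck_on k g S"
  using assms(2,3)
proof (induction k arbitrary: f g)
  case 0
  then show ?case by (simp cong: continuous_on_cong)
next
  case (Suc k)
  have "g differentiable (at x)" if "x \<in> S" for x
  proof -
    have "f differentiable (at x)" using Suc.prems that by simp
    then obtain D where "(f has_derivative D) (at x)"
      unfolding differentiable_def by blast
    then have "(g has_derivative D) (at x)"
      using has_derivative_transform_within_open[OF _ assms(1) that] Suc.prems by blast
    then show ?thesis by (auto simp: differentiable_def)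
  qed
  moreover have "Ck_on k (\<lambda>x. frechet_derivative g (at x) v) S" for v
  proof (rule Suc.IH)
    show "Ck_on k (\<lambda>x. frechet_derivative f (at x) v) S" using Suc.prems by auto
    show "frechet_derivative f (at x) v = frechet_derivative g (at x) v" if "x \<in> S" for x
      using frechet_derivative_transform_within_open[of f x S g] assms(1) that Suc.prems by simp
  qed
  ultimately show ?case by simp
qed

lemma Ck_on_SucD: "Ck_on (Suc k) f S \<Longrightarrow> Ck_on k f S"
proof (induction k arbitrary: f)
  case 0
  then show ?case
    by (simp add: continuous_at_imp_continuous_on differentiable_imp_continuous_within)
next
  case (Suc k)
  have "Ck_on k (\<lambda>x. frechet_derivative f (at x) v) S" for v
    by (rule Suc.IH) (use Suc.prems in auto)
  with Suc.prems show ?case by auto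
qed

lemma Ck_on_const: "Ck_on k (\<lambda>x. c) S"
proof (induction k arbitrary: c)
  case (Suc k)
  have "frechet_derivative (\<lambda>x. c) (at x) = (\<lambda>v. 0)" for x :: 'a
    by (rule frechet_derivative_const)
  with Suc show ?case by simp
qed simp

lemma Ck_on_bounded_linear: "bounded_linear f \<Longrightarrow> Ck_on k f S"
proof (cases k)
  case 0
  then show "bounded_linear f \<Longrightarrow> Ck_on k f S" by (simp add: linear_continuous_on)
next
  case (Suc m)
  assume f: "bounded_linear f"
  then have "(f has_derivative f) (at x)" for x by (rule bounded_linear_imp_has_derivative)
  moreover from this have "frechet_derivative f (at x) = f" for x
    using frechet_derivative_at by metis
  ultimately show "Ck_on k f S"
    using Suc by (auto simp: Ck_on_const differentiable_def)
qed

lemma frechet_derivative_add_fun: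
  assumes "f differentiable at x" "g differentiable at x"
  shows "frechet_derivative (\<lambda>x. f x + g x) (at x) v =
      frechet_derivative f (at x) v + frechet_derivative g (at x) v"
proof -
  have "((\<lambda>x. f x + g x) has_derivative
      (\<lambda>v. frechet_derivative f (at x) v + frechet_derivative g (at x) v)) (at x)"
    using assms by (intro has_derivative_add) (simp_all add: frechet_derivative_works[symmetric])
  then show ?thesis using frechet_derivative_at by metis
qed

lemma Ck_on_add:
  assumes "open S" "Ck_on k f S" "Ck_on k g S"
  shows "Ck_on k (\<lambda>x. f x + g x) S"
  using assms(2,3)
proof (induction k arbitrary: f g)
  case 0
  then show ?case by (simp add: continuous_on_add)
next
  case (Suc k)
  have "Ck_on k (\<lambda>x. frechet_derivative (\<lambda>x. f x + g x) (at x) v) S" for v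
  proof (rule Ck_on_cong[OF assms(1) Suc.IH])
    show "Ck_on k (\<lambda>x. frechet_derivative f (at x) v) S" "Ck_on k (\<lambda>x. frechet_derivative g (at x) v) S"
      using Suc.prems by auto
    show "frechet_derivative f (at x) v + frechet_derivative g (at x) v =
        frechet_derivative (\<lambda>x. f x + g x) (at x) v" if "x \<in> S" for x
      using Suc.prems that by (simp add: frechet_derivative_add_fun)
  qed
  with Suc.prems show ?case by (auto intro: differentiable_add)
qed

lemma frechet_derivative_mult_real:
  fixes f g :: "'e::real_normed_vector \<Rightarrow> real"
  assumes "f differentiable at x" "g differentiable at x"
  shows "frechet_derivative (\<lambda>x. f x * g x) (at x) v =
      f x * frechet_derivative g (at x) v + frechet_derivative f (at x) v * g x"
proof -
  have "((\<lambda>x. f x * g x) has_derivative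
      (\<lambda>v. f x * frechet_derivative g (at x) v + frechet_derivative f (at x) v * g x)) (at x)"
    using assms by (intro has_derivative_mult) (simp_all add: frechet_derivative_works[symmetric])
  then show ?thesis by (metis frechet_derivative_at)
qed

text \<open>The product rule returns \<open>f\<close> and \<open>g\<close> themselves next to their
  derivatives, so the induction hypothesis is applied to a derivative paired with an
  undifferentiated factor, whose order is lowered by \<open>Ck_on_SucD\<close>.\<close>

lemma Ck_on_mult:
  fixes f g :: "'e::real_normed_vector \<Rightarrow> real"
  assumes "open S" "Ck_on k f S" "Ck_on k g S"
  shows "Ck_on k (\<lambda>x. f x * g x) S"
  using assms(2,3)
proof (induction k arbitrary: f g)
  case 0
  then show ?case by (simp add: continuous_on_mult)
next
  case (Suc k)
  have "Ck_on k (\<lambda>x. frechet_derivative (\<lambda>x. f x * g x) (at x) v) S" for v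
  proof (rule Ck_on_cong[OF assms(1)])
    show "Ck_on k (\<lambda>x. f x * frechet_derivative g (at x) v + frechet_derivative f (at x) v * g x) S"
      using Suc.prems by (intro Ck_on_add assms(1) Suc.IH) (auto intro: Ck_on_SucD)
    show "f x * frechet_derivative g (at x) v + frechet_derivative f (at x) v * g x =
        frechet_derivative (\<lambda>x. f x * g x) (at x) v" if "x \<in> S" for x
      using Suc.prems that by (simp add: frechet_derivative_mult_real)
  qed
  with Suc.prems show ?case by (auto intro: differentiable_mult)
qed

lemma frechet_derivative_inverse_real:
  fixes f :: "'e::real_normed_vector \<Rightarrow> real"
  assumes "f differentiable at x" "f x \<noteq> 0"
  shows "frechet_derivative (\<lambda>x. inverse (f x)) (at x) v =
      - (inverse (f x) * frechet_derivative f (at x) v * inverse (f x))"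
proof -
  have "((\<lambda>x. inverse (f x)) has_derivative
      (\<lambda>v. - (inverse (f x) * frechet_derivative f (at x) v * inverse (f x)))) (at x)"
    using assms by (intro Deriv.has_derivative_inverse) (simp_all add: frechet_derivative_works[symmetric])
  then show ?thesis by (metis frechet_derivative_at)
qed

text \<open>The derivative of \<open>1/f\<close> contains \<open>1/f\<close> again, so the claim at
  order \<open>k\<close> is fed back into the product rule to reach order
  \<open>k + 1\<close>.\<close>

lemma Ck_on_inverse:
  fixes f :: "'e::real_normed_vector \<Rightarrow> real"
  assumes "open S" "Ck_on k f S" "\<And>x. x \<in> S \<Longrightarrow> f x \<noteq> 0"
  shows "Ck_on k (\<lambda>x. inverse (f x)) S"
  using assms(2)
proof (induction k)
  case 0
  then show ?case using assms(3) by (simp add: continuous_on_inverse)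
next
  case (Suc k)
  have k: "Ck_on k (\<lambda>x. inverse (f x)) S"
    by (rule Suc.IH[OF Ck_on_SucD[OF Suc.prems]])
  have "Ck_on k (\<lambda>x. frechet_derivative (\<lambda>x. inverse (f x)) (at x) v) S" for v
  proof (rule Ck_on_cong[OF assms(1)])
    show "Ck_on k (\<lambda>x. (-1) * (inverse (f x) * frechet_derivative f (at x) v * inverse (f x))) S"
      using Suc.prems by (intro Ck_on_mult assms(1) k Ck_on_const) auto
    show "(-1) * (inverse (f x) * frechet_derivative f (at x) v * inverse (f x)) =
        frechet_derivative (\<lambda>x. inverse (f x)) (at x) v" if "x \<in> S" for x
      using Suc.prems that assms(3) by (simp add: frechet_derivative_inverse_real)
  qed
  moreover have "(\<lambda>x. inverse (f x)) differentiable (at x)" if "x \<in> S" for x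
    using Suc.prems that assms(3) by (intro differentiable_inverse) auto
  ultimately show ?case by simp
qed

lemma frechet_derivative_compose_linear:
  assumes "f differentiable at (T x)" "bounded_linear T"
  shows "frechet_derivative (\<lambda>x. f (T x)) (at x) v = frechet_derivative f (at (T x)) (T v)"
proof -
  have "((\<lambda>x. f (T x)) has_derivative (\<lambda>v. frechet_derivative f (at (T x)) (T v))) (at x)"
    using has_derivative_compose[OF bounded_linear_imp_has_derivative[OF assms(2)],
        of f "frechet_derivative f (at (T x))"] assms(1)
    by (simp add: frechet_derivative_works[symmetric])
  then show ?thesis by (metis frechet_derivative_at)
qed

text \<open>As \<open>T\<close> is linear, differentiating in direction \<open>v\<close> gives the
  derivative of \<open>f\<close> in the fixed direction \<open>T v\<close>, again composed with
  \<open>T\<close>. The induction thus reproduces its own form.\<close>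

lemma Ck_on_compose_linear:
  assumes "open S" "bounded_linear T" "Ck_on k f S"
  shows "Ck_on k (\<lambda>x. f (T x)) (T -` S)"
  using assms(3)
proof (induction k arbitrary: f)
  case 0
  then show ?case
    using continuous_on_compose2[of S f "T -` S" T] linear_continuous_on[OF assms(2)] by auto
next
  case (Suc k)
  have op: "open (T -` S)"
    using assms(1,2) by (auto intro!: open_vimage simp: linear_continuous_on)
  have "Ck_on k (\<lambda>x. frechet_derivative (\<lambda>x. f (T x)) (at x) v) (T -` S)" for v
  proof (rule Ck_on_cong[OF op])
    show "Ck_on k (\<lambda>x. frechet_derivative f (at (T x)) (T v)) (T -` S)"
      using Suc.prems by (intro Suc.IH) auto
    show "frechet_derivative f (at (T x)) (T v) = frechet_derivative (\<lambda>x. f (T x)) (at x) v"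
      if "x \<in> T -` S" for x
      using Suc.prems that assms(2) by (simp add: frechet_derivative_compose_linear)
  qed
  moreover have "(\<lambda>x. f (T x)) differentiable (at x)" if "x \<in> T -` S" for x
    using differentiable_compose[of f T x UNIV] Suc.prems that
      bounded_linear_imp_differentiable[OF assms(2)] by auto
  ultimately show ?case by simp
qed

lemma Ck_on_subset: "Ck_on k f S \<Longrightarrow> T \<subseteq> S \<Longrightarrow> Ck_on k f T"
  by (induction k arbitrary: f) (auto intro: continuous_on_subset)

lemma smooth_on_cong:
  "open S \<Longrightarrow> smooth_on f S \<Longrightarrow> (\<And>x. x \<in> S \<Longrightarrow> f x = g x) \<Longrightarrow> smooth_on g S"
  unfolding smooth_on_def using Ck_on_cong by blast

lemma smooth_on_subset: "smooth_on f S \<Longrightarrow> T \<subseteq> S \<Longrightarrow> smooth_on f T"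
  unfolding smooth_on_def using Ck_on_subset by blast

lemma smooth_on_const: "smooth_on (\<lambda>x. c) S"
  by (simp add: smooth_on_def Ck_on_const)

lemma smooth_on_bounded_linear: "bounded_linear f \<Longrightarrow> smooth_on f S"
  by (simp add: smooth_on_def Ck_on_bounded_linear)

lemma smooth_on_add: "open S \<Longrightarrow> smooth_on f S \<Longrightarrow> smooth_on g S \<Longrightarrow> smooth_on (\<lambda>x. f x + g x) S"
  by (simp add: smooth_on_def Ck_on_add)

lemma smooth_on_mult:
  fixes f g :: "'e::real_normed_vector \<Rightarrow> real"
  shows "open S \<Longrightarrow> smooth_on f S \<Longrightarrow> smooth_on g S \<Longrightarrow> smooth_on (\<lambda>x. f x * g x) S"
  by (simp add: smooth_on_def Ck_on_mult)

lemma smooth_on_inverse: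
  fixes f :: "'e::real_normed_vector \<Rightarrow> real"
  shows "open S \<Longrightarrow> smooth_on f S \<Longrightarrow> (\<And>x. x \<in> S \<Longrightarrow> f x \<noteq> 0) \<Longrightarrow> smooth_on (\<lambda>x. inverse (f x)) S"
  by (simp add: smooth_on_def Ck_on_inverse)

lemma smooth_on_sum:
  "open S \<Longrightarrow> (\<And>i. i \<in> I \<Longrightarrow> smooth_on (f i) S) \<Longrightarrow> smooth_on (\<lambda>x. \<Sum>i\<in>I. f i x) S"
  by (induction I rule: infinite_finite_induct) (auto simp: smooth_on_const intro: smooth_on_add)

lemma smooth_on_prod:
  fixes f :: "'i \<Rightarrow> 'e::real_normed_vector \<Rightarrow> real"
  shows "open S \<Longrightarrow> (\<And>i. i \<in> I \<Longrightarrow> smooth_on (f i) S) \<Longrightarrow> smooth_on (\<lambda>x. \<Prod>i\<in>I. f i x) S"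
  by (induction I rule: infinite_finite_induct) (auto simp: smooth_on_const intro: smooth_on_mult)

lemma smooth_on_compose_linear:
  "open S \<Longrightarrow> bounded_linear T \<Longrightarrow> smooth_on f S \<Longrightarrow> smooth_on (\<lambda>x. f (T x)) (T -` S)"
  by (simp add: smooth_on_def Ck_on_compose_linear)

lemma smooth_on_imp_differentiable: "smooth_on f S \<Longrightarrow> x \<in> S \<Longrightarrow> f differentiable (at x)"
  unfolding smooth_on_def by (metis Ck_on.simps(2))

lemma smooth_on_imp_continuous_on: "smooth_on f S \<Longrightarrow> continuous_on S f"
  unfolding smooth_on_def by (metis Ck_on.simps(1))

lemma smooth_on_frechet_derivative:
  "smooth_on f S \<Longrightarrow> smooth_on (\<lambda>x. frechet_derivative f (at x) v) S"
  unfolding smooth_on_def by (metis Ck_on.simps(2))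

section \<open>Determinants and inverse matrices depending smoothly on a parameter\<close>

lemma smooth_on_det:
  fixes A :: "'e::real_normed_vector \<Rightarrow> real^'n::finite^'n"
  assumes "open S" "\<And>i j. smooth_on (\<lambda>x. A x $ i $ j) S"
  shows "smooth_on (\<lambda>x. det (A x)) S"
  unfolding det_def
  by (intro smooth_on_sum smooth_on_mult smooth_on_prod smooth_on_const assms)

lemma
  fixes A :: "real^'n::finite^'n"
  assumes "invertible A"
  shows matrix_inv_right: "A ** matrix_inv A = mat 1"
    and matrix_inv_left: "matrix_inv A ** A = mat 1"
  using someI_ex[OF assms[unfolded invertible_def]] by (simp_all add: matrix_inv_def)

text \<open>Column \<open>j\<close> of the inverse solves \<open>A z = axis j 1\<close>, so Cramer's
  rule makes every entry of the inverse a rational, hence smooth, function of the entries of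
  \<open>A\<close>.\<close>

lemma matrix_inv_cramer:
  fixes A :: "real^'n::finite^'n"
  assumes "det A \<noteq> 0"
  shows "matrix_inv A $ i $ j = det (\<chi> r s. if s = i then (axis j 1 :: real^'n) $ r else A $ r $ s) * inverse (det A)"
proof -
  have inv: "invertible A" using assms by (simp add: invertible_det_nz)
  have "A *v column j (matrix_inv A) = axis j 1"
  proof -
    have "A *v column j (matrix_inv A) = column j (A ** matrix_inv A)"
      by (simp add: column_def matrix_vector_mult_def matrix_matrix_mult_def vec_eq_iff)
    also have "\<dots> = axis j 1"
      using matrix_inv_right[OF inv] by (auto simp: column_def mat_def axis_def vec_eq_iff)
    finally show ?thesis .
  qed
  then have "column j (matrix_inv A) =
      (\<chi> k. det (\<chi> r s. if s = k then (axis j 1 :: real^'n) $ r else A $ r $ s) / det A)"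
    using cramer[OF assms] by blast
  then have "column j (matrix_inv A) $ i =
      det (\<chi> r s. if s = i then (axis j 1 :: real^'n) $ r else A $ r $ s) / det A" by simp
  then show ?thesis by (simp add: column_def divide_inverse)
qed

lemma smooth_on_matrix_inv:
  fixes A :: "'e::real_normed_vector \<Rightarrow> real^'n::finite^'n"
  assumes "open S" "\<And>i j. smooth_on (\<lambda>x. A x $ i $ j) S" "\<And>x. x \<in> S \<Longrightarrow> invertible (A x)"
  shows "smooth_on (\<lambda>x. matrix_inv (A x) $ i $ j) S"
proof (rule smooth_on_cong[OF assms(1)])
  show "smooth_on (\<lambda>x. det (\<chi> r s. if s = i then (axis j 1 :: real^'n) $ r else A x $ r $ s) *
      inverse (det (A x))) S"
  proof (intro smooth_on_mult smooth_on_inverse smooth_on_det assms(1,2))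
    show "smooth_on (\<lambda>x. (\<chi> r s. if s = i then (axis j 1 :: real^'n) $ r else A x $ r $ s) $ k $ l) S" for k l
      using assms(2) by (cases "l = i") (auto simp: smooth_on_const)
  qed (use assms(3) in \<open>simp add: invertible_det_nz\<close>)
qed (use assms(3) in \<open>simp add: matrix_inv_cramer invertible_det_nz\<close>)

section \<open>Smooth functions of position and velocity\<close>

text \<open>Curried, because \<open>dx\<close> and \<open>dy\<close> act on curried functions; over
  a set of pairs, because joint smoothness is what keeps repeated mixed partial derivatives
  smooth.\<close>

definition smooth2 :: "((real^'n) \<times> (real^'n)) set \<Rightarrow> (real^'n::finite \<Rightarrow> real^'n \<Rightarrow> real) \<Rightarrow> bool" where
  "smooth2 W h \<longleftrightarrow> smooth_on (\<lambda>z. h (fst z) (snd z)) W"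

lemma smooth2_cong:
  "open W \<Longrightarrow> smooth2 W f \<Longrightarrow> (\<And>x y. (x, y) \<in> W \<Longrightarrow> f x y = g x y) \<Longrightarrow> smooth2 W g"
  unfolding smooth2_def by (rule smooth_on_cong, assumption, assumption) auto

lemma smooth2_const: "smooth2 W (\<lambda>x y. c)"
  by (simp add: smooth2_def smooth_on_const)

lemma smooth2_fst: "open U \<Longrightarrow> smooth_on h U \<Longrightarrow> W \<subseteq> U \<times> UNIV \<Longrightarrow> smooth2 W (\<lambda>x y. h x)"
  unfolding smooth2_def
  by (rule smooth_on_subset[OF smooth_on_compose_linear[OF _ bounded_linear_fst]]) auto

lemma smooth2_snd_nth: "smooth2 W (\<lambda>x y. y $ i)"
  unfolding smooth2_def
  by (intro smooth_on_bounded_linear bounded_linear_compose[OF bounded_linear_vec_nth bounded_linear_snd])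

lemma smooth2_add: "open W \<Longrightarrow> smooth2 W f \<Longrightarrow> smooth2 W g \<Longrightarrow> smooth2 W (\<lambda>x y. f x y + g x y)"
  unfolding smooth2_def by (rule smooth_on_add)

lemma smooth2_mult: "open W \<Longrightarrow> smooth2 W f \<Longrightarrow> smooth2 W g \<Longrightarrow> smooth2 W (\<lambda>x y. f x y * g x y)"
  unfolding smooth2_def by (rule smooth_on_mult)

lemma smooth2_diff:
  assumes "open W" "smooth2 W f" "smooth2 W g"
  shows "smooth2 W (\<lambda>x y. f x y - g x y)"
  using smooth2_add[OF assms(1,2) smooth2_mult[OF assms(1) smooth2_const[of _ "-1"] assms(3)]] by simp

lemma smooth2_inverse:
  "open W \<Longrightarrow> smooth2 W f \<Longrightarrow> (\<And>x y. (x, y) \<in> W \<Longrightarrow> f x y \<noteq> 0) \<Longrightarrow> smooth2 W (\<lambda>x y. inverse (f x y))"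
  unfolding smooth2_def by (rule smooth_on_inverse) auto

lemma smooth2_sum:
  "open W \<Longrightarrow> (\<And>i. i \<in> I \<Longrightarrow> smooth2 W (f i)) \<Longrightarrow> smooth2 W (\<lambda>x y. \<Sum>i\<in>I. f i x y)"
  unfolding smooth2_def by (rule smooth_on_sum)

lemma smooth2_matrix_inv:
  fixes A :: "real^'n::finite \<Rightarrow> real^'n \<Rightarrow> real^'k::finite^'k"
  assumes "open W" "\<And>i j. smooth2 W (\<lambda>x y. A x y $ i $ j)" "\<And>x y. (x, y) \<in> W \<Longrightarrow> invertible (A x y)"
  shows "smooth2 W (\<lambda>x y. matrix_inv (A x y) $ i $ j)"
  using assms unfolding smooth2_def by (intro smooth_on_matrix_inv) auto

text \<open>Both partial derivatives are values of one total derivative. Through this,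
  \<open>dx\<close> and \<open>dy\<close> preserve joint smoothness.\<close>

lemma
  assumes "smooth2 W h" "(x, y) \<in> W"
  shows smooth2_diff_fst: "(\<lambda>x. h x y) differentiable (at x)"
    and smooth2_diff_snd: "(\<lambda>y. h x y) differentiable (at y)"
    and dx_eq: "dx i h x y = frechet_derivative (\<lambda>z. h (fst z) (snd z)) (at (x, y)) (axis i 1, 0)"
    and dy_eq: "dy i h x y = frechet_derivative (\<lambda>z. h (fst z) (snd z)) (at (x, y)) (0, axis i 1)"
proof -
  let ?D = "frechet_derivative (\<lambda>z. h (fst z) (snd z)) (at (x, y))"
  have D: "((\<lambda>z. h (fst z) (snd z)) has_derivative ?D) (at (x, y))"
    using assms smooth_on_imp_differentiable unfolding smooth2_def frechet_derivative_works by blast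
  have 1: "((\<lambda>x. h x y) has_derivative (\<lambda>v. ?D (v, 0))) (at x)"
    using has_derivative_compose[OF has_derivative_Pair[OF has_derivative_ident has_derivative_const] D]
    by simp
  have 2: "((\<lambda>y. h x y) has_derivative (\<lambda>v. ?D (0, v))) (at y)"
    using has_derivative_compose[OF has_derivative_Pair[OF has_derivative_const has_derivative_ident] D]
    by simp
  show "(\<lambda>x. h x y) differentiable (at x)" "(\<lambda>y. h x y) differentiable (at y)"
    using 1 2 by (auto simp: differentiable_def)
  show "dx i h x y = ?D (axis i 1, 0)" "dy i h x y = ?D (0, axis i 1)"
    unfolding dx_def dy_def
    using fun_cong[OF frechet_derivative_at[OF 1], of "axis i 1"]
      fun_cong[OF frechet_derivative_at[OF 2], of "axis i 1"] by simp_all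
qed

lemma smooth2_dx: "open W \<Longrightarrow> smooth2 W h \<Longrightarrow> smooth2 W (dx i h)"
  unfolding smooth2_def[of _ "dx i h"]
  by (rule smooth_on_cong[OF _ smooth_on_frechet_derivative[OF smooth2_def[THEN iffD1]]])
    (auto simp: dx_eq)

lemma smooth2_dy: "open W \<Longrightarrow> smooth2 W h \<Longrightarrow> smooth2 W (dy i h)"
  unfolding smooth2_def[of _ "dy i h"]
  by (rule smooth_on_cong[OF _ smooth_on_frechet_derivative[OF smooth2_def[THEN iffD1]]])
    (auto simp: dy_eq)

lemmas smooth2_intros = smooth2_const smooth2_snd_nth smooth2_add smooth2_mult smooth2_diff
  smooth2_sum smooth2_dx smooth2_dy

text \<open>The slices of \<open>W\<close> in either argument are open, and a derivative sees only
  values near the point. This allows an identity valid on \<open>W\<close> to be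
  differentiated.\<close>

lemma
  assumes "open W" "(x, y) \<in> W" "smooth2 W f" "\<And>x y. (x, y) \<in> W \<Longrightarrow> g x y = f x y"
  shows dx_cong: "dx i g x y = dx i f x y" and dy_cong: "dy i g x y = dy i f x y"
proof -
  have "open ((\<lambda>x. (x, y)) -` W)" "open ((\<lambda>y. (x, y)) -` W)"
    using assms(1) by (auto intro!: open_vimage continuous_intros)
  then show "dx i g x y = dx i f x y" "dy i g x y = dy i f x y"
    unfolding dx_def dy_def
    using frechet_derivative_transform_within_open[of "\<lambda>x. f x y" x "(\<lambda>x. (x, y)) -` W" "\<lambda>x. g x y"]
      frechet_derivative_transform_within_open[of "f x" y "(\<lambda>y. (x, y)) -` W" "g x"]
      smooth2_diff_fst[OF assms(3,2)] smooth2_diff_snd[OF assms(3,2)] assms(2,4)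
    by auto
qed

lemma dx_const [simp]: "dx i (\<lambda>x y. h y) x y = 0"
  by (simp add: dx_def)

lemma dy_const [simp]: "dy i (\<lambda>x y. h x) x y = 0"
  by (simp add: dy_def)

lemma dy_nth [simp]: "dy i (\<lambda>x y. y $ j) x y = (if i = j then 1 else 0)"
proof -
  have "((\<lambda>y. y $ j) has_derivative (\<lambda>y. y $ j)) (at y)" for y :: "real^'a"
    by (rule bounded_linear_imp_has_derivative[OF bounded_linear_vec_nth])
  from frechet_derivative_at[OF this, symmetric] show ?thesis
    by (auto simp: dy_def axis_def)
qed

lemma
  assumes "smooth2 W f" "smooth2 W g" "(x, y) \<in> W"
  shows dx_add: "dx i (\<lambda>x y. f x y + g x y) x y = dx i f x y + dx i g x y"
    and dy_add: "dy i (\<lambda>x y. f x y + g x y) x y = dy i f x y + dy i g x y"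
    and dx_mult: "dx i (\<lambda>x y. f x y * g x y) x y = f x y * dx i g x y + dx i f x y * g x y"
    and dy_mult: "dy i (\<lambda>x y. f x y * g x y) x y = f x y * dy i g x y + dy i f x y * g x y"
  unfolding dx_def dy_def
  using smooth2_diff_fst[OF assms(1,3)] smooth2_diff_fst[OF assms(2,3)]
    smooth2_diff_snd[OF assms(1,3)] smooth2_diff_snd[OF assms(2,3)]
  by (simp_all add: frechet_derivative_add_fun frechet_derivative_mult_real)

lemma dx_cmult:
  assumes "smooth2 W f" "(x, y) \<in> W"
  shows "dx i (\<lambda>x y. c * f x y) x y = c * dx i f x y"
  using dx_mult[OF smooth2_const assms, of i c] by simp

lemma
  assumes "open W" "\<And>k. k \<in> I \<Longrightarrow> smooth2 W (f k)" "(x, y) \<in> W"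
  shows dx_sum: "dx i (\<lambda>x y. \<Sum>k\<in>I. f k x y) x y = (\<Sum>k\<in>I. dx i (f k) x y)"
    and dy_sum: "dy i (\<lambda>x y. \<Sum>k\<in>I. f k x y) x y = (\<Sum>k\<in>I. dy i (f k) x y)"
proof -
  have "dx i (\<lambda>x y. \<Sum>k\<in>I. f k x y) x y = (\<Sum>k\<in>I. dx i (f k) x y) \<and>
      dy i (\<lambda>x y. \<Sum>k\<in>I. f k x y) x y = (\<Sum>k\<in>I. dy i (f k) x y)"
    using assms(2)
  proof (induction I rule: infinite_finite_induct)
    case (insert k I)
    then have "smooth2 W (\<lambda>x y. \<Sum>k\<in>I. f k x y)" "smooth2 W (f k)"
      by (auto intro: smooth2_sum assms(1))
    with insert show ?case
      by (simp add: dx_add[OF _ _ assms(3)] dy_add[OF _ _ assms(3)])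
  qed simp_all
  then show "dx i (\<lambda>x y. \<Sum>k\<in>I. f k x y) x y = (\<Sum>k\<in>I. dx i (f k) x y)"
    "dy i (\<lambda>x y. \<Sum>k\<in>I. f k x y) x y = (\<Sum>k\<in>I. dy i (f k) x y)" by auto
qed

section \<open>Pull-backs along coordinate projections\<close>

definition sub_vec :: "('k::finite \<Rightarrow> 'n::finite) \<Rightarrow> real^'n \<Rightarrow> real^'k" where
  "sub_vec j x = (\<chi> i. x $ j i)"

text \<open>For \<open>j = Inl\<close> or \<open>j = Inr\<close> this moves a function on the
  tangent bundle of a factor to that of the product, in coordinates.\<close>

definition pullback ::
    "('k::finite \<Rightarrow> 'n::finite) \<Rightarrow> (real^'k \<Rightarrow> real^'k \<Rightarrow> real) \<Rightarrow> real^'n \<Rightarrow> real^'n \<Rightarrow> real" where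
  "pullback j h x y = h (sub_vec j x) (sub_vec j y)"

lemma bounded_linear_sub_vec: "bounded_linear (sub_vec j)"
  unfolding sub_vec_def linear_conv_bounded_linear[symmetric]
  by (rule linearI) (simp_all add: vec_eq_iff)

lemma sub_vec_nth [simp]: "sub_vec j x $ i = x $ j i"
  by (simp add: sub_vec_def)

lemma sub_vec_axis: "inj j \<Longrightarrow> sub_vec j (axis (j i) 1) = axis i 1"
  by (auto simp: sub_vec_def axis_def vec_eq_iff inj_eq)

lemma sub_vec_axis_notin: "k \<notin> range j \<Longrightarrow> sub_vec j (axis k 1) = 0"
  by (auto simp: sub_vec_def axis_def vec_eq_iff)

lemma smooth2_pullback:
  fixes W :: "((real^'n::finite) \<times> (real^'n)) set"
  assumes "open V" "smooth2 V h" "\<And>x y. (x, y) \<in> W \<Longrightarrow> (sub_vec j x, sub_vec j y) \<in> V"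
  shows "smooth2 W (pullback j h)"
proof -
  let ?T = "\<lambda>z::(real^'n) \<times> (real^'n). (sub_vec j (fst z), sub_vec j (snd z))"
  have "bounded_linear ?T"
    by (intro bounded_linear_Pair bounded_linear_compose[OF bounded_linear_sub_vec]
        bounded_linear_fst bounded_linear_snd)
  from smooth_on_compose_linear[OF assms(1) this assms(2)[unfolded smooth2_def]]
  have "smooth_on (\<lambda>z. h (sub_vec j (fst z)) (sub_vec j (snd z))) (?T -` V)" by simp
  then show ?thesis
    unfolding smooth2_def pullback_def by (rule smooth_on_subset) (use assms(3) in auto)
qed

text \<open>Chain rule for a linear projection, which maps each basis vector of the large space to a
  basis vector or to \<open>0\<close>.\<close>

lemma
  assumes "smooth2 V h" "(sub_vec j x, sub_vec j y) \<in> V"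
  shows dx_pullback: "inj j \<Longrightarrow> dx (j i) (pullback j h) x y = pullback j (dx i h) x y"
    and dy_pullback: "inj j \<Longrightarrow> dy (j i) (pullback j h) x y = pullback j (dy i h) x y"
    and dx_pullback_notin: "k \<notin> range j \<Longrightarrow> dx k (pullback j h) x y = 0"
    and dy_pullback_notin: "k \<notin> range j \<Longrightarrow> dy k (pullback j h) x y = 0"
proof -
  have d: "(\<lambda>x. h x (sub_vec j y)) differentiable (at (sub_vec j x))"
    "h (sub_vec j x) differentiable (at (sub_vec j y))"
    using smooth2_diff_fst[OF assms] smooth2_diff_snd[OF assms] by auto
  have 0: "frechet_derivative (\<lambda>x. h x (sub_vec j y)) (at (sub_vec j x)) 0 = 0"
    "frechet_derivative (h (sub_vec j x)) (at (sub_vec j y)) 0 = 0"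
    using d linear_0 linear_frechet_derivative by metis+
  show "inj j \<Longrightarrow> dx (j i) (pullback j h) x y = pullback j (dx i h) x y"
    "inj j \<Longrightarrow> dy (j i) (pullback j h) x y = pullback j (dy i h) x y"
    "k \<notin> range j \<Longrightarrow> dx k (pullback j h) x y = 0"
    "k \<notin> range j \<Longrightarrow> dy k (pullback j h) x y = 0"
    unfolding dx_def dy_def pullback_def
      frechet_derivative_compose_linear[of "\<lambda>x. h x (sub_vec j y)", OF d(1) bounded_linear_sub_vec]
      frechet_derivative_compose_linear[of "h (sub_vec j x)", OF d(2) bounded_linear_sub_vec]
    by (simp_all add: sub_vec_axis sub_vec_axis_notin 0)
qed

lemma linear_expand_axis:
  fixes D :: "real^'n::finite \<Rightarrow> real"
  assumes "linear D"
  shows "D v = (\<Sum>i\<in>UNIV. v $ i * D (axis i 1))"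
proof -
  have "D v = D (\<Sum>i\<in>UNIV. v $ i *\<^sub>R axis i 1)"
    using basis_expansion[of v] by (simp add: scalar_mult_eq_scaleR)
  then show ?thesis using assms by (simp add: linear_sum linear_cmul)
qed

section \<open>Homogeneity in the velocity\<close>

definition conic :: "((real^'n::finite) \<times> (real^'n)) set \<Rightarrow> bool" where
  "conic W \<longleftrightarrow> (\<forall>x y t. (x, y) \<in> W \<longrightarrow> t > 0 \<longrightarrow> (x, t *\<^sub>R y) \<in> W)"

definition homogeneous ::
    "((real^'n::finite) \<times> (real^'n)) set \<Rightarrow> nat \<Rightarrow> (real^'n \<Rightarrow> real^'n \<Rightarrow> real) \<Rightarrow> bool" where
  "homogeneous W k h \<longleftrightarrow> (\<forall>x y t. (x, y) \<in> W \<longrightarrow> t > 0 \<longrightarrow> h x (t *\<^sub>R y) = t ^ k * h x y)"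

lemma homogeneousD: "homogeneous W k h \<Longrightarrow> (x, y) \<in> W \<Longrightarrow> t > 0 \<Longrightarrow> h x (t *\<^sub>R y) = t ^ k * h x y"
  by (simp add: homogeneous_def)

text \<open>Differentiate \<open>h x (t y)\<close> in \<open>t\<close> at \<open>t = 1\<close> twice
  over: by the chain rule, and as the multiple \<open>t ^ k\<close> of \<open>h x y\<close>.\<close>

lemma euler_homogeneous:
  assumes "open W" "smooth2 W h" "homogeneous W k h" "(x, y) \<in> W"
  shows "(\<Sum>i\<in>UNIV. y $ i * dy i h x y) = real k * h x y"
proof -
  let ?D = "frechet_derivative (h x) (at y)"
  have D: "(h x has_derivative ?D) (at y)"
    using smooth2_diff_snd[OF assms(2,4)] frechet_derivative_works by blast
  have "((\<lambda>t::real. t *\<^sub>R y) has_derivative (\<lambda>t. t *\<^sub>R y)) (at 1)"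
    by (auto intro!: derivative_eq_intros)
  from has_derivative_compose[OF this, of "h x"] D
  have 1: "((\<lambda>t::real. h x (t *\<^sub>R y)) has_derivative (\<lambda>t. ?D (t *\<^sub>R y))) (at 1)"
    by simp
  have "((\<lambda>t::real. t ^ k * h x y) has_derivative (\<lambda>t. t * (real k * h x y))) (at 1)"
    by (auto intro!: derivative_eq_intros)
  then have 2: "((\<lambda>t::real. h x (t *\<^sub>R y)) has_derivative (\<lambda>t. t * (real k * h x y))) (at 1)"
    by (rule has_derivative_transform_within_open[of _ _ _ _ "{0<..}"])
      (use homogeneousD[OF assms(3,4)] in auto)
  have "?D y = real k * h x y"
    using fun_cong[OF has_derivative_unique[OF 1 2], of 1] by simp
  then show ?thesis
    using linear_expand_axis[OF has_derivative_linear[OF D], of y] by (simp add: dy_def)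
qed

lemma homogeneous_dx:
  assumes "open W" "conic W" "smooth2 W h" "homogeneous W k h"
  shows "homogeneous W k (dx i h)"
  unfolding homogeneous_def
proof (intro allI impI)
  fix x y and t :: real
  assume xy: "(x, y) \<in> W" and t: "t > 0"
  have op: "open ((\<lambda>x. (x, y)) -` W)"
    using assms(1) by (auto intro!: open_vimage continuous_intros)
  have "frechet_derivative (\<lambda>x. t ^ k * h x y) (at x) = frechet_derivative (\<lambda>x. h x (t *\<^sub>R y)) (at x)"
    using smooth2_diff_fst[OF assms(3) xy] homogeneousD[OF assms(4) _ t] xy
    by (intro frechet_derivative_transform_within_open[OF _ op]) auto
  moreover have "frechet_derivative (\<lambda>x. t ^ k * h x y) (at x) (axis i 1) = t ^ k * dx i h x y"
    using smooth2_diff_fst[OF assms(3) xy] by (simp add: dx_def frechet_derivative_mult_real)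
  ultimately show "dx i h x (t *\<^sub>R y) = t ^ k * dx i h x y"
    by (simp add: dx_def)
qed

text \<open>Differentiating the homogeneity relation in \<open>y\<close> brings out a factor
  \<open>t\<close> from the inner scaling, and cancelling it lowers the degree. The cone condition
  puts the scaled point in \<open>W\<close>, where \<open>h\<close> is differentiable.\<close>

lemma homogeneous_dy:
  assumes "open W" "conic W" "smooth2 W h" "homogeneous W (Suc k) h"
  shows "homogeneous W k (dy i h)"
  unfolding homogeneous_def
proof (intro allI impI)
  fix x y and t :: real
  assume xy: "(x, y) \<in> W" and t: "t > 0"
  have txy: "(x, t *\<^sub>R y) \<in> W" using assms(2) xy t by (simp add: conic_def)
  have op: "open ((\<lambda>y. (x, y)) -` W)"
    using assms(1) by (auto intro!: open_vimage continuous_intros)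
  have "frechet_derivative (\<lambda>y. t ^ Suc k * h x y) (at y) = frechet_derivative (\<lambda>y. h x (t *\<^sub>R y)) (at y)"
    using smooth2_diff_snd[OF assms(3) xy] homogeneousD[OF assms(4) _ t] xy
    by (intro frechet_derivative_transform_within_open[OF _ op]) auto
  moreover have "frechet_derivative (\<lambda>y. t ^ Suc k * h x y) (at y) (axis i 1) = t ^ Suc k * dy i h x y"
    using smooth2_diff_snd[OF assms(3) xy] by (simp add: dy_def frechet_derivative_mult_real)
  moreover have "frechet_derivative (\<lambda>y. h x (t *\<^sub>R y)) (at y) (axis i 1) = t * dy i h x (t *\<^sub>R y)"
    using frechet_derivative_compose_linear[of "h x" "\<lambda>y. t *\<^sub>R y" y, OF _ bounded_linear_scaleR_right]
      smooth2_diff_snd[OF assms(3) txy] linear_frechet_derivative[OF smooth2_diff_snd[OF assms(3) txy]]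
    by (simp add: dy_def linear_cmul)
  ultimately show "dy i h x (t *\<^sub>R y) = t ^ k * dy i h x y"
    using t by simp
qed

section \<open>Sprays and Ricci curvature of an energy function\<close>

text \<open>The Finsler quantities depend on \<open>L\<close> only through its square. Phrased for
  that square, they apply directly to the warped energy, which is a sum with no root in it.\<close>

definition energy_tensor ::
    "(real^'n::finite \<Rightarrow> real^'n \<Rightarrow> real) \<Rightarrow> 'n \<Rightarrow> 'n \<Rightarrow> real^'n \<Rightarrow> real^'n \<Rightarrow> real" where
  "energy_tensor E i j x y = 1/2 * dy i (dy j E) x y"

definition energy_spray ::
    "(real^'n::finite \<Rightarrow> real^'n \<Rightarrow> real) \<Rightarrow> 'n \<Rightarrow> real^'n \<Rightarrow> real^'n \<Rightarrow> real" where
  "energy_spray E i x y = 1/4 * (\<Sum>l\<in>UNIV. matrix_inv (\<chi> i j. energy_tensor E i j x y) $ i $ l *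
     ((\<Sum>k\<in>UNIV. dx k (dy l E) x y * y $ k) - dx l E x y))"

text \<open>The trace of the Riemann curvature for arbitrary spray coefficients. Detached from the
  metric, it lets a closed form of the spray be substituted before anything is
  differentiated.\<close>

definition spray_ricci ::
    "('n::finite \<Rightarrow> real^'n \<Rightarrow> real^'n \<Rightarrow> real) \<Rightarrow> real^'n \<Rightarrow> real^'n \<Rightarrow> real" where
  "spray_ricci G x y = (\<Sum>i\<in>UNIV.
     2 * dx i (G i) x y
     - (\<Sum>j\<in>UNIV. y $ j * dx j (dy i (G i)) x y)
     + 2 * (\<Sum>j\<in>UNIV. G j x y * dy j (dy i (G i)) x y)
     - (\<Sum>j\<in>UNIV. dy j (G i) x y * dy i (G j) x y))"

lemma fundamental_tensor_eq: "fundamental_tensor L i j x y = energy_tensor (\<lambda>x y. (L x y)\<^sup>2) i j x y"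
  by (simp add: fundamental_tensor_def energy_tensor_def)

lemma spray_eq: "spray L = energy_spray (\<lambda>x y. (L x y)\<^sup>2)"
  by (intro ext) (simp add: spray_def energy_spray_def inverse_tensor_def fundamental_tensor_eq)

lemma Ric_eq: "Ric L x y = spray_ricci (energy_spray (\<lambda>x y. (L x y)\<^sup>2)) x y"
  by (simp add: Ric_def riemann_curvature_def spray_ricci_def spray_eq)

lemma energy_tensor_cong:
  assumes "open W" "smooth2 W E" "\<And>x y. (x, y) \<in> W \<Longrightarrow> E' x y = E x y" "(x, y) \<in> W"
  shows "energy_tensor E' i j x y = energy_tensor E i j x y"
  unfolding energy_tensor_def
  by (subst dy_cong[OF assms(1,4) smooth2_dy[OF assms(1,2)]]) (auto intro: dy_cong assms)

lemma energy_spray_cong: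
  assumes "open W" "smooth2 W E" "\<And>x y. (x, y) \<in> W \<Longrightarrow> E' x y = E x y" "(x, y) \<in> W"
  shows "energy_spray E' i x y = energy_spray E i x y"
proof -
  have "dx k (dy l E') x y = dx k (dy l E) x y" for k l
    by (rule dx_cong[OF assms(1,4) smooth2_dy[OF assms(1,2)]]) (auto intro: dy_cong assms)
  moreover have "dx l E' x y = dx l E x y" for l
    by (rule dx_cong[OF assms(1,4,2,3)])
  ultimately show ?thesis
    using energy_tensor_cong[OF assms] by (simp add: energy_spray_def)
qed

text \<open>Second derivatives of the coefficients occur, so the first derivatives must be matched
  on all of \<open>W\<close> before differentiating again.\<close>

lemma spray_ricci_cong:
  assumes "open W" "\<And>i. smooth2 W (G i)" "\<And>i x y. (x, y) \<in> W \<Longrightarrow> G' i x y = G i x y" "(x, y) \<in> W"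
  shows "spray_ricci G' x y = spray_ricci G x y"
proof -
  have 1: "dx i (G' j) x y = dx i (G j) x y" "dy i (G' j) x y = dy i (G j) x y"
    if "(x, y) \<in> W" for i j x y
    using that by (auto intro: dx_cong dy_cong assms)
  have "dx i (dy j (G' k)) x y = dx i (dy j (G k)) x y"
    "dy i (dy j (G' k)) x y = dy i (dy j (G k)) x y" for i j k
    by (rule dx_cong dy_cong, rule assms, rule assms, rule smooth2_dy[OF assms(1,2)], rule 1, assumption)+
  then show ?thesis
    using 1[OF assms(4)] assms(3)[OF assms(4)] by (simp add: spray_ricci_def)
qed

lemma smooth2_energy_spray:
  assumes "open W" "smooth2 W E" "\<And>x y. (x, y) \<in> W \<Longrightarrow> invertible (\<chi> i j. energy_tensor E i j x y)"
  shows "smooth2 W (energy_spray E i)"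
proof -
  have "smooth2 W (energy_tensor E i j)" for i j
    unfolding energy_tensor_def using assms(1,2) by (intro smooth2_intros)
  then have "smooth2 W (\<lambda>x y. matrix_inv (\<chi> i j. energy_tensor E i j x y) $ i $ j)" for i j
    using assms(1,3) by (intro smooth2_matrix_inv) auto
  with assms(1,2) show ?thesis
    unfolding energy_spray_def[abs_def] by (intro smooth2_intros)
qed

text \<open>The tensor of \<open>E\<close> and its inverse have degree 0 in the velocity. The
  bracket has degree 2: \<open>dx k (dy l E)\<close> has degree 1 and is multiplied by a component
  of \<open>y\<close>, and \<open>dx l E\<close> keeps the degree of \<open>E\<close>.\<close>

lemma homogeneous_energy_spray:
  assumes "open W" "conic W" "smooth2 W E" "homogeneous W 2 E"
  shows "homogeneous W 2 (energy_spray E i)"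
  unfolding homogeneous_def
proof (intro allI impI)
  fix x y and t :: real
  assume xy: "(x, y) \<in> W" and t: "t > 0"
  have 1: "homogeneous W 1 (dy l E)" for l
    by (rule homogeneous_dy[OF assms(1-3)]) (use assms(4) in \<open>simp add: numeral_2_eq_2\<close>)
  have "homogeneous W 0 (dy k (dy l E))" for k l
    using homogeneous_dy[OF assms(1,2) smooth2_dy[OF assms(1,3)], of 0 l k] 1 by simp
  then have A: "energy_tensor E k l x (t *\<^sub>R y) = energy_tensor E k l x y" for k l
    using homogeneousD[OF _ xy t] by (fastforce simp: energy_tensor_def)
  have B: "dx k (dy l E) x (t *\<^sub>R y) = t * dx k (dy l E) x y" for k l
    using homogeneousD[OF homogeneous_dx[OF assms(1,2) smooth2_dy[OF assms(1,3)] 1] xy t] by simp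
  have C: "dx l E x (t *\<^sub>R y) = t\<^sup>2 * dx l E x y" for l
    using homogeneousD[OF homogeneous_dx[OF assms] xy t] by simp
  show "energy_spray E i x (t *\<^sub>R y) = t\<^sup>2 * energy_spray E i x y"
    by (simp add: energy_spray_def A B C sum_distrib_left sum_distrib_right algebra_simps power2_eq_square)
qed

text \<open>Each \<open>dy\<close> lowers the degree by one, a factor \<open>y $ j\<close> raises it
  by one and \<open>dx\<close> preserves it; every summand ends up with degree 2.\<close>

lemma homogeneous_spray_ricci:
  assumes "open W" "conic W" "\<And>i. smooth2 W (G i)" "\<And>i. homogeneous W 2 (G i)"
  shows "homogeneous W 2 (spray_ricci G)"
  unfolding homogeneous_def
proof (intro allI impI)
  fix x y and t :: real
  assume xy: "(x, y) \<in> W" and t: "t > 0"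
  have 1: "homogeneous W 1 (dy k (G l))" for k l
    by (rule homogeneous_dy[OF assms(1-3)]) (use assms(4) in \<open>simp add: numeral_2_eq_2\<close>)
  have 0: "homogeneous W 0 (dy i (dy k (G l)))" for i k l
    using homogeneous_dy[OF assms(1,2) smooth2_dy[OF assms(1,3)], of 0 k l i] 1 by simp
  note H = homogeneousD[OF _ xy t]
  have "dx i (dy k (G l)) x (t *\<^sub>R y) = t * dx i (dy k (G l)) x y"
    "dy k (G l) x (t *\<^sub>R y) = t * dy k (G l) x y"
    "dy i (dy k (G l)) x (t *\<^sub>R y) = dy i (dy k (G l)) x y"
    "dx k (G l) x (t *\<^sub>R y) = t\<^sup>2 * dx k (G l) x y"
    "G l x (t *\<^sub>R y) = t\<^sup>2 * G l x y" for i k l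
    using H[OF homogeneous_dx[OF assms(1,2) smooth2_dy[OF assms(1,3)] 1]] H[OF 1] H[OF 0] H[OF assms(4)]
      H[OF homogeneous_dx[OF assms]] by simp_all
  then show "spray_ricci G x (t *\<^sub>R y) = t\<^sup>2 * spray_ricci G x y"
    by (simp add: spray_ricci_def sum_distrib_left algebra_simps power2_eq_square)
qed

section \<open>Sums and block matrices over a disjoint union of indices\<close>

lemma sum_UNIV_Plus:
  fixes f :: "'m::finite + 'n::finite \<Rightarrow> 'c::comm_monoid_add"
  shows "(\<Sum>k\<in>UNIV. f k) = (\<Sum>i\<in>UNIV. f (Inl i)) + (\<Sum>j\<in>UNIV. f (Inr j))"
  unfolding UNIV_Plus_UNIV[symmetric] by (subst sum.Plus) simp_all

lemma matrix_inv_unique: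
  fixes A B :: "real^'n::finite^'n"
  assumes "A ** B = mat 1"
  shows "matrix_inv A = B"
proof -
  have "invertible A"
    using assms matrix_left_right_inverse unfolding invertible_def by blast
  then have "matrix_inv A ** (A ** B) = B"
    by (simp add: matrix_mul_assoc matrix_inv_left)
  then show ?thesis by (simp add: assms)
qed

text \<open>The fundamental tensor of a warped product has this shape, with \<open>P\<close> from
  the base, \<open>Q\<close> from the fiber and \<open>c\<close> the value of the squared warping
  function.\<close>

lemma matrix_inv_block:
  fixes A :: "real^('m::finite + 'n::finite)^('m + 'n)" and P :: "real^'m^'m" and Q :: "real^'n^'n"
  assumes "invertible P" "invertible Q" "c \<noteq> 0"
    "\<And>i j. A $ Inl i $ Inl j = P $ i $ j" "\<And>i j. A $ Inl i $ Inr j = 0"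
    "\<And>i j. A $ Inr i $ Inl j = 0" "\<And>i j. A $ Inr i $ Inr j = c * Q $ i $ j"
  shows "matrix_inv A $ Inl i $ Inl j = matrix_inv P $ i $ j" (is ?a)
    and "matrix_inv A $ Inl i $ Inr j' = 0" (is ?b)
    and "matrix_inv A $ Inr i' $ Inl j = 0" (is ?c)
    and "matrix_inv A $ Inr i' $ Inr j' = matrix_inv Q $ i' $ j' / c" (is ?d)
proof -
  define B :: "real^('m + 'n)^('m + 'n)" where "B = (\<chi> k l. case k of
      Inl i \<Rightarrow> (case l of Inl j \<Rightarrow> matrix_inv P $ i $ j | Inr j \<Rightarrow> 0)
    | Inr i \<Rightarrow> (case l of Inl j \<Rightarrow> 0 | Inr j \<Rightarrow> matrix_inv Q $ i $ j / c))"
  have P: "(\<Sum>k\<in>UNIV. P $ i $ k * matrix_inv P $ k $ j) = (if i = j then 1 else 0)" for i j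
    using matrix_inv_right[OF assms(1)] by (simp add: matrix_matrix_mult_def mat_def vec_eq_iff)
  have Q: "(\<Sum>k\<in>UNIV. Q $ i $ k * matrix_inv Q $ k $ j) = (if i = j then 1 else 0)" for i j
    using matrix_inv_right[OF assms(2)] by (simp add: matrix_matrix_mult_def mat_def vec_eq_iff)
  have "(A ** B) $ k $ l = mat 1 $ k $ l" for k l
    by (cases k; cases l)
      (simp_all add: matrix_matrix_mult_def sum_UNIV_Plus B_def assms mat_def P Q)
  then have "A ** B = mat 1" by (simp add: vec_eq_iff)
  then have "matrix_inv A = B" by (rule matrix_inv_unique)
  then show ?a ?b ?c ?d by (simp_all add: B_def)
qed

section \<open>The spray of a warped product\<close>

lemma sub_vec_Inl_Inr [simp]:
  "Inr k \<notin> range Inl" "Inl k' \<notin> range Inr"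
  by auto

text \<open>A chart of the base together with a chart of the fiber: \<open>b\<close> is the Gram
  matrix of the Riemannian metric, \<open>F\<close> the square of the warping function and
  \<open>E2\<close> the square of the Finsler metric, all in coordinates. Of \<open>b\<close> only
  symmetry and invertibility are built in; its sign enters in \<open>A_nonneg\<close>.\<close>

locale warped_energy =
  fixes U :: "(real^'m::finite) set" and V :: "(real^'n::finite) set"
    and b :: "real^'m \<Rightarrow> real^'m^'m" and F :: "real^'m \<Rightarrow> real"
    and E2 :: "real^'n \<Rightarrow> real^'n \<Rightarrow> real"
  assumes open_U: "open U" and open_V: "open V"
    and smooth_b: "\<And>i j. smooth_on (\<lambda>x. b x $ i $ j) U"
    and sym_b: "\<And>x i j. x \<in> U \<Longrightarrow> b x $ i $ j = b x $ j $ i"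
    and inv_b: "\<And>x. x \<in> U \<Longrightarrow> invertible (b x)"
    and smooth_F: "smooth_on F U" and F_pos: "\<And>x. x \<in> U \<Longrightarrow> F x > 0"
    and smooth_E2: "smooth2 (V \<times> (UNIV - {0})) E2"
    and hom_E2: "homogeneous (V \<times> (UNIV - {0})) 2 E2"
    and inv_E2: "\<And>x y. x \<in> V \<Longrightarrow> y \<noteq> 0 \<Longrightarrow> invertible (\<chi> i j. energy_tensor E2 i j x y)"
begin

abbreviation "WU \<equiv> U \<times> (UNIV :: (real^'m) set)"
abbreviation "WV \<equiv> V \<times> (UNIV - {0 :: real^'n})"

text \<open>Only vanishing fiber velocities are excluded: \<open>E1\<close> is a quadratic form and
  smooth across \<open>y = 0\<close>, while \<open>E2\<close> is smooth only off the zero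
  section.\<close>

definition W :: "((real^('m + 'n)) \<times> (real^('m + 'n))) set" where
  "W = {z. sub_vec Inl (fst z) \<in> U \<and> sub_vec Inr (fst z) \<in> V \<and> sub_vec Inr (snd z) \<noteq> 0}"

definition E1 :: "real^'m \<Rightarrow> real^'m \<Rightarrow> real" where
  "E1 x y = (\<Sum>i\<in>UNIV. \<Sum>j\<in>UNIV. b x $ i $ j * (y $ i * y $ j))"

definition E :: "real^('m + 'n) \<Rightarrow> real^('m + 'n) \<Rightarrow> real" where
  "E x y = pullback Inl E1 x y + pullback Inl (\<lambda>x y. F x) x y * pullback Inr E2 x y"

lemma open_WU: "open WU" and open_WV: "open WV"
  using open_U open_V by (auto intro: open_Times)

lemma conic_WU: "conic WU"
  by (auto simp: conic_def)

lemma open_W: "open W"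
proof -
  have "continuous_on UNIV (\<lambda>z::(real^('m + 'n)) \<times> (real^('m + 'n)). (sub_vec Inl (fst z) :: real^'m, sub_vec Inr (fst z) :: real^'n, sub_vec Inr (snd z) :: real^'n))"
    by (intro continuous_intros bounded_linear.continuous_on[OF bounded_linear_sub_vec])
  then have "open ((\<lambda>z::(real^('m + 'n)) \<times> (real^('m + 'n)). (sub_vec Inl (fst z), sub_vec Inr (fst z), sub_vec Inr (snd z))) -` (U \<times> V \<times> (UNIV - {0})))"
    using open_U open_V by (intro open_vimage open_Times) auto
  also have "\<dots> = W" by (auto simp: W_def)
  finally show ?thesis .
qed

lemma W_D: "(x, y) \<in> W \<Longrightarrow> (sub_vec Inl x, sub_vec Inl y) \<in> WU"
  "(x, y) \<in> W \<Longrightarrow> (sub_vec Inr x, sub_vec Inr y) \<in> WV"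
  "(x, y) \<in> W \<Longrightarrow> sub_vec Inl x \<in> U"
  by (auto simp: W_def)

lemma smooth2_pullback_Inl: "smooth2 WU h \<Longrightarrow> smooth2 W (pullback Inl h)"
  by (rule smooth2_pullback[OF open_WU]) (auto simp: W_def)

lemma smooth2_pullback_Inr: "smooth2 WV h \<Longrightarrow> smooth2 W (pullback Inr h)"
  by (rule smooth2_pullback[OF open_WV]) (auto simp: W_def)

lemma dx_pullback_W:
  assumes "(x, y) \<in> W"
  shows "smooth2 WU h \<Longrightarrow> dx (Inl i) (pullback Inl h) x y = pullback Inl (dx i h) x y"
    "smooth2 WU h \<Longrightarrow> dx (Inr k) (pullback Inl h) x y = 0"
    "smooth2 WV l \<Longrightarrow> dx (Inl i) (pullback Inr l) x y = 0"
    "smooth2 WV l \<Longrightarrow> dx (Inr k) (pullback Inr l) x y = pullback Inr (dx k l) x y"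
  using W_D[OF assms]
  by (auto intro!: dx_pullback dx_pullback_notin)

lemma dy_pullback_W:
  assumes "(x, y) \<in> W"
  shows "smooth2 WU h \<Longrightarrow> dy (Inl i) (pullback Inl h) x y = pullback Inl (dy i h) x y"
    "smooth2 WU h \<Longrightarrow> dy (Inr k) (pullback Inl h) x y = 0"
    "smooth2 WV l \<Longrightarrow> dy (Inl i) (pullback Inr l) x y = 0"
    "smooth2 WV l \<Longrightarrow> dy (Inr k) (pullback Inr l) x y = pullback Inr (dy k l) x y"
  using W_D[OF assms]
  by (auto intro!: dy_pullback dy_pullback_notin)

lemma smooth2_WU_fst: "smooth_on h U \<Longrightarrow> smooth2 WU (\<lambda>x y. h x)"
  by (rule smooth2_fst[OF open_U]) auto

lemma smooth2_F: "smooth2 WU (\<lambda>x y. F x)"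
  by (rule smooth2_WU_fst[OF smooth_F])

lemma smooth2_E1: "smooth2 WU E1"
  unfolding E1_def[abs_def]
  by (intro smooth2_intros open_WU smooth2_WU_fst smooth_b)

lemma dy_E1:
  assumes "x \<in> U"
  shows "dy k E1 x y = 2 * (\<Sum>j\<in>UNIV. b x $ k $ j * y $ j)"
proof -
  have xy: "(x, y) \<in> WU" using assms by simp
  have s: "smooth2 WU (\<lambda>x y. y $ i * y $ j)" for i j
    by (intro smooth2_intros open_WU)
  have "dy k E1 x y = (\<Sum>i\<in>UNIV. \<Sum>j\<in>UNIV. b x $ i $ j * (y $ i * (if k = j then 1 else 0) + (if k = i then 1 else 0) * y $ j))"
    unfolding E1_def[abs_def]
    by (simp add: dy_sum[OF open_WU _ xy] dy_mult[OF _ _ xy] s smooth2_intros open_WU smooth2_WU_fst smooth_b)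
  also have "\<dots> = (\<Sum>i\<in>UNIV. b x $ i $ k * y $ i) + (\<Sum>j\<in>UNIV. b x $ k $ j * y $ j)"
  proof -
    have "b x $ i $ j * (y $ i * (if k = j then 1 else 0) + (if k = i then 1 else 0) * y $ j) =
        (if k = j then b x $ i $ k * y $ i else 0) + (if k = i then b x $ k $ j * y $ j else 0)" for i j
      by auto
    moreover have "(\<Sum>i\<in>UNIV. \<Sum>j\<in>UNIV. if k = i then b x $ k $ j * y $ j else 0) =
        (\<Sum>j\<in>UNIV. b x $ k $ j * y $ j)"
      by (subst sum.swap) simp
    ultimately show ?thesis by (simp add: sum.distrib)
  qed
  also have "(\<Sum>i\<in>UNIV. b x $ i $ k * y $ i) = (\<Sum>j\<in>UNIV. b x $ k $ j * y $ j)"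
    using sym_b[OF assms] by simp
  finally show ?thesis by simp
qed

lemma energy_tensor_E1:
  assumes "x \<in> U"
  shows "energy_tensor E1 i k x y = b x $ i $ k"
proof -
  have xy: "(x, y) \<in> WU" using assms by simp
  have "dy i (dy k E1) x y = dy i (\<lambda>x y. 2 * (\<Sum>j\<in>UNIV. b x $ k $ j * y $ j)) x y"
    by (rule dy_cong[OF open_WU xy])
      (auto simp: dy_E1 intro!: smooth2_intros open_WU smooth2_WU_fst smooth_b)
  also have "\<dots> = 2 * b x $ k $ i"
    by (simp add: dy_sum[OF open_WU _ xy] dy_mult[OF _ _ xy] smooth2_intros open_WU smooth2_WU_fst smooth_b
        if_distrib[of "\<lambda>c. _ * c"] cong: if_cong)
  finally show ?thesis using sym_b[OF assms] by (simp add: energy_tensor_def)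
qed

text \<open>The velocity argument \<open>0\<close> is a dummy, as \<open>F\<close> depends on the position only.\<close>

definition v :: "'m \<Rightarrow> real^'m \<Rightarrow> real^'m \<Rightarrow> real" where
  "v a x y = - 1/4 * (\<Sum>l\<in>UNIV. matrix_inv (b x) $ a $ l * dx l (\<lambda>x y. F x) x 0)"

text \<open>This is the differential of \<open>log f\<close> applied to \<open>y\<close> when
  \<open>F\<close> is the square of \<open>f\<close>.\<close>

definition \<phi> :: "real^'m \<Rightarrow> real^'m \<Rightarrow> real" where
  "\<phi> x y = (\<Sum>c\<in>UNIV. dx c (\<lambda>x y. F x) x 0 * y $ c) * inverse (2 * F x)"

lemma smooth_dF: "smooth2 WU (\<lambda>x y. dx l (\<lambda>x y. F x) x 0)"
  using smooth2_dx[OF open_WU smooth2_F, of l] by (simp add: dx_def[abs_def])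

lemma smooth_v: "smooth2 WU (v a)"
proof -
  have "smooth2 WU (\<lambda>x y. matrix_inv (b x) $ a $ l)" for l
    using inv_b by (intro smooth2_matrix_inv open_WU smooth2_WU_fst smooth_b) auto
  then show ?thesis
    unfolding v_def[abs_def] by (intro smooth2_intros open_WU smooth_dF)
qed

lemma smooth_\<phi>: "smooth2 WU \<phi>"
proof -
  have "smooth2 WU (\<lambda>x y. inverse (2 * F x))"
    using F_pos by (intro smooth2_inverse smooth2_intros open_WU smooth2_F) force
  then show ?thesis
    unfolding \<phi>_def[abs_def] by (intro smooth2_intros open_WU smooth_dF)
qed

lemmas smooth_W = smooth2_pullback_Inl smooth2_pullback_Inr smooth2_F smooth2_E1 smooth_E2
  smooth2_dx[OF open_WU] smooth2_dy[OF open_WU] smooth2_dx[OF open_WV] smooth2_dy[OF open_WV]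
  smooth_dF smooth_v smooth_\<phi>
  smooth2_const smooth2_snd_nth smooth2_add[OF open_W] smooth2_mult[OF open_W]

lemma smooth_E: "smooth2 W E"
  unfolding E_def[abs_def] by (intro smooth_W)

lemma dy_E:
  assumes "(x, y) \<in> W"
  shows "dy (Inl i) E x y = pullback Inl (dy i E1) x y"
    and "dy (Inr k) E x y = pullback Inl (\<lambda>x y. F x) x y * pullback Inr (dy k E2) x y"
  unfolding E_def[abs_def]
  by (simp_all add: dy_add[OF _ _ assms] dy_mult[OF _ _ assms] smooth_W dy_pullback_W[OF assms])
    (simp add: pullback_def)

lemma dx_E:
  assumes "(x, y) \<in> W"
  shows "dx (Inl i) E x y = pullback Inl (dx i E1) x y + pullback Inl (dx i (\<lambda>x y. F x)) x y * pullback Inr E2 x y"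
    and "dx (Inr k) E x y = pullback Inl (\<lambda>x y. F x) x y * pullback Inr (dx k E2) x y"
  unfolding E_def[abs_def]
  by (simp_all add: dx_add[OF _ _ assms] dx_mult[OF _ _ assms] smooth_W dx_pullback_W[OF assms])

text \<open>The mixed velocity derivatives vanish, so the tensor of \<open>E\<close> is block
  diagonal. The factors are coupled only through position derivatives of \<open>F\<close>, as in
  \<open>dx (Inl j) (dy (Inr k) E)\<close>.\<close>

lemma
  assumes xy: "(x, y) \<in> W"
  shows dy_dy_E_Inl: "dy (Inl j) (dy (Inl i) E) x y = pullback Inl (dy j (dy i E1)) x y"
      "dy (Inr l) (dy (Inl i) E) x y = 0"
    and dx_dy_E_Inl: "dx (Inl j) (dy (Inl i) E) x y = pullback Inl (dx j (dy i E1)) x y"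
      "dx (Inr l) (dy (Inl i) E) x y = 0"
    and dy_dy_E_Inr: "dy (Inl j) (dy (Inr k) E) x y = 0"
      "dy (Inr l) (dy (Inr k) E) x y = pullback Inl (\<lambda>x y. F x) x y * pullback Inr (dy l (dy k E2)) x y"
    and dx_dy_E_Inr: "dx (Inl j) (dy (Inr k) E) x y = pullback Inl (dx j (\<lambda>x y. F x)) x y * pullback Inr (dy k E2) x y"
      "dx (Inr l) (dy (Inr k) E) x y = pullback Inl (\<lambda>x y. F x) x y * pullback Inr (dx l (dy k E2)) x y"
proof -
  have s: "smooth2 W (pullback Inl (dy i E1))"
    "smooth2 W (\<lambda>x y. pullback Inl (\<lambda>x y. F x) x y * pullback Inr (dy k E2) x y)"
    by (intro smooth_W)+
  note c = dx_cong[OF open_W xy s(1) dy_E(1)] dy_cong[OF open_W xy s(1) dy_E(1)]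
    dx_cong[OF open_W xy s(2) dy_E(2)] dy_cong[OF open_W xy s(2) dy_E(2)]
  show "dy (Inl j) (dy (Inl i) E) x y = pullback Inl (dy j (dy i E1)) x y"
      "dy (Inr l) (dy (Inl i) E) x y = 0"
      "dx (Inl j) (dy (Inl i) E) x y = pullback Inl (dx j (dy i E1)) x y"
      "dx (Inr l) (dy (Inl i) E) x y = 0"
      "dy (Inl j) (dy (Inr k) E) x y = 0"
      "dy (Inr l) (dy (Inr k) E) x y = pullback Inl (\<lambda>x y. F x) x y * pullback Inr (dy l (dy k E2)) x y"
      "dx (Inl j) (dy (Inr k) E) x y = pullback Inl (dx j (\<lambda>x y. F x)) x y * pullback Inr (dy k E2) x y"
      "dx (Inr l) (dy (Inr k) E) x y = pullback Inl (\<lambda>x y. F x) x y * pullback Inr (dx l (dy k E2)) x y"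
    by (simp_all add: c dx_mult[OF _ _ xy] dy_mult[OF _ _ xy] smooth_W dx_pullback_W[OF xy] dy_pullback_W[OF xy])
      (simp add: pullback_def)
qed

lemma invertible_energy_tensor_E1: "x \<in> U \<Longrightarrow> invertible (\<chi> i j. energy_tensor E1 i j x y)"
  using inv_b by (simp add: energy_tensor_E1 flip: vec_eq_iff)

text \<open>The inverse tensor is block diagonal. In base directions the bracket gains only the term
  \<open>- dF E2\<close> from \<open>dx l E\<close>, which becomes \<open>v\<close>. In fiber
  directions it gains \<open>dF(y1)\<close> times \<open>dy l E2\<close>; raising the index by the
  inverse tensor turns \<open>dy l E2\<close> into twice the velocity, which gives
  \<open>\<phi>\<close> times the velocity.\<close>

lemma energy_spray_E:
  assumes xy: "(x, y) \<in> W"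
  shows "energy_spray E (Inl a) x y = pullback Inl (energy_spray E1 a) x y + pullback Inl (v a) x y * pullback Inr E2 x y"
    and "energy_spray E (Inr k) x y = pullback Inr (energy_spray E2 k) x y + pullback Inl \<phi> x y * y $ Inr k"
proof -
  define x1 x2 y1 y2 where "x1 = sub_vec Inl x" and "x2 = sub_vec Inr x" and "y1 = sub_vec Inl y" and "y2 = sub_vec Inr y"
  note d = x1_def x2_def y1_def y2_def
  have x1: "x1 \<in> U" and x2: "x2 \<in> V" and y2: "y2 \<noteq> 0"
    using xy by (auto simp: W_def d)
  have F: "F x1 > 0" using F_pos x1 .
  have xy2: "(x2, y2) \<in> WV" using x2 y2 by auto
  let ?A = "\<chi> i j. energy_tensor E i j x y"
  let ?Q = "\<chi> i j. energy_tensor E2 i j x2 y2"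
  have entries: "?A $ Inl i $ Inl j = b x1 $ i $ j" "?A $ Inl i $ Inr l = 0"
    "?A $ Inr k $ Inl j = 0" "?A $ Inr k $ Inr l = F x1 * ?Q $ k $ l" for i j k l
    using energy_tensor_E1[OF x1, of i j y1]
    by (simp_all add: energy_tensor_def dy_dy_E_Inl[OF xy] dy_dy_E_Inr[OF xy] pullback_def d)
  note inv = matrix_inv_block[OF inv_b[OF x1] inv_E2[OF x2 y2] _ entries]
  have b: "(\<chi> i j. energy_tensor E1 i j x1 y1) = b x1"
    by (simp add: energy_tensor_E1[OF x1] vec_eq_iff)
  have y_nth: "y $ Inl i = y1 $ i" "y $ Inr k = y2 $ k" for i k
    by (simp_all add: d)
  have dF: "dx i (\<lambda>x y. F x) x1 y1 = dx i (\<lambda>x y. F x) x1 0" for i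
    by (simp add: dx_def)
  show "energy_spray E (Inl a) x y = pullback Inl (energy_spray E1 a) x y + pullback Inl (v a) x y * pullback Inr E2 x y"
    using F unfolding energy_spray_def sum_UNIV_Plus pullback_def
    by (simp add: inv dx_dy_E_Inl[OF xy] dx_E[OF xy] pullback_def flip: d)
      (simp add: b v_def dF y_nth sum_distrib_left sum_distrib_right algebra_simps sum_subtractf sum.distrib sum_negf)
  \<comment> \<open>Differentiating Euler's identity for \<open>E2\<close> once more in the velocity
    shows that \<open>dy l E2\<close> is twice the tensor of \<open>E2\<close> applied to
    \<open>y2\<close>; the inverse matrix then cancels the tensor.\<close>
  have euler: "(\<Sum>l\<in>UNIV. matrix_inv ?Q $ k $ l * dy l E2 x2 y2) = 2 * y2 $ k"
  proof -
    have "dy l E2 x2 y2 = 2 * (?Q *v y2) $ l" for l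
    proof -
      have "dy l (\<lambda>x y. \<Sum>i\<in>UNIV. y $ i * dy i E2 x y) x2 y2 = dy l (\<lambda>x y. 2 * E2 x y) x2 y2"
        using euler_homogeneous[OF open_WV smooth_E2 hom_E2]
        by (intro dy_cong[OF open_WV xy2]) (auto intro!: smooth2_intros open_WV smooth_E2)
      then have "(\<Sum>i\<in>UNIV. y2 $ i * dy l (dy i E2) x2 y2) + dy l E2 x2 y2 = 2 * dy l E2 x2 y2"
        by (simp add: dy_sum[OF open_WV _ xy2] dy_mult[OF _ _ xy2] smooth2_intros open_WV smooth_E2
            sum.distrib if_distrib[of "\<lambda>c. c * _"] cong: if_cong)
      then show ?thesis
        by (simp add: energy_tensor_def matrix_vector_mult_def sum_distrib_left algebra_simps)
    qed
    then have "(\<Sum>l\<in>UNIV. matrix_inv ?Q $ k $ l * dy l E2 x2 y2) = 2 * (matrix_inv ?Q *v (?Q *v y2)) $ k"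
      by (simp add: matrix_vector_mult_def[of "matrix_inv ?Q"] sum_distrib_left algebra_simps)
    then show ?thesis
      by (simp add: matrix_vector_mul_assoc matrix_inv_left[OF inv_E2[OF x2 y2]])
  qed
  show "energy_spray E (Inr k) x y = pullback Inr (energy_spray E2 k) x y + pullback Inl \<phi> x y * y $ Inr k"
  proof -
    define S where "S = (\<Sum>c\<in>UNIV. dx c (\<lambda>x y. F x) x1 0 * y1 $ c)"
    define T where "T l = (\<Sum>m\<in>UNIV. dx m (dy l E2) x2 y2 * y2 $ m) - dx l E2 x2 y2" for l
    have "energy_spray E (Inr k) x y =
        1/4 * (\<Sum>l\<in>UNIV. matrix_inv ?Q $ k $ l / F x1 * (S * dy l E2 x2 y2 + F x1 * T l))"
      using F unfolding energy_spray_def sum_UNIV_Plus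
      by (simp add: inv dx_dy_E_Inr[OF xy] dx_E[OF xy] pullback_def y_nth flip: d)
        (simp add: S_def T_def dF sum_distrib_left sum_distrib_right algebra_simps)
    also have "\<dots> = 1/4 * ((\<Sum>l\<in>UNIV. matrix_inv ?Q $ k $ l * T l) +
        S / F x1 * (\<Sum>l\<in>UNIV. matrix_inv ?Q $ k $ l * dy l E2 x2 y2))"
      using F by (simp add: sum_distrib_left field_simps flip: sum.distrib)
    also have "\<dots> = energy_spray E2 k x2 y2 + S / (2 * F x1) * y2 $ k"
      unfolding euler by (simp add: energy_spray_def T_def field_simps)
    finally show ?thesis
      unfolding pullback_def \<phi>_def y_nth d[symmetric] S_def[symmetric] by (simp only: divide_inverse)
  qed
qed

end

section \<open>Ricci curvature over a critical point of the warping function\<close>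

lemma sub_vec_join [simp]: "sub_vec Inl (vec_join x y) = x" "sub_vec Inr (vec_join x y) = y"
  by (simp_all add: vec_join_def vec_eq_iff)

lemma vec_join_sub_vec [simp]: "vec_join (sub_vec Inl x) (sub_vec Inr x) = x"
  by (auto simp: vec_join_def vec_eq_iff split: sum.split)

context warped_energy
begin

text \<open>A name for the closed form of the spray, so that \<open>spray_ricci_cong\<close> can put
  it in place of \<open>energy_spray E\<close> on \<open>W\<close>.\<close>

definition G :: "'m + 'n \<Rightarrow> real^('m + 'n) \<Rightarrow> real^('m + 'n) \<Rightarrow> real" where
  "G k = (case k of
      Inl a \<Rightarrow> (\<lambda>x y. pullback Inl (energy_spray E1 a) x y + pullback Inl (v a) x y * pullback Inr E2 x y)
    | Inr k \<Rightarrow> (\<lambda>x y. pullback Inr (energy_spray E2 k) x y + pullback Inl \<phi> x y * y $ Inr k))"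

lemma energy_spray_eq_G: "(x, y) \<in> W \<Longrightarrow> energy_spray E k x y = G k x y"
  by (cases k) (simp_all add: energy_spray_E G_def)

lemma smooth_spray_E1: "smooth2 WU (energy_spray E1 a)"
  by (rule smooth2_energy_spray[OF open_WU smooth2_E1]) (auto intro: invertible_energy_tensor_E1)

lemma smooth_spray_E2: "smooth2 WV (energy_spray E2 k)"
  by (rule smooth2_energy_spray[OF open_WV smooth_E2]) (auto intro: inv_E2)

lemmas smooth_W' = smooth_W smooth_spray_E1 smooth_spray_E2

lemma smooth_G: "smooth2 W (G k)"
  unfolding G_def by (cases k) (auto intro!: smooth_W')

lemma dy_v [simp]: "dy j (v a) x y = 0"
  by (simp add: v_def[abs_def])

text \<open>These are the first derivatives that enter the trace: all velocity derivatives, but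
  position derivatives only of \<open>G i\<close> in directions belonging to the same
  factor.\<close>

lemma
  assumes xy: "(x, y) \<in> W"
  shows dy_G_Inl: "dy (Inl j) (G (Inl a)) x y = pullback Inl (dy j (energy_spray E1 a)) x y"
      "dy (Inr l) (G (Inl a)) x y = pullback Inl (v a) x y * pullback Inr (dy l E2) x y"
    and dy_G_Inr: "dy (Inl j) (G (Inr k)) x y = pullback Inl (dy j \<phi>) x y * y $ Inr k"
      "dy (Inr l) (G (Inr k)) x y = pullback Inr (dy l (energy_spray E2 k)) x y + (if l = k then pullback Inl \<phi> x y else 0)"
    and dx_G: "dx (Inl j) (G (Inl a)) x y = pullback Inl (dx j (energy_spray E1 a)) x y + pullback Inl (dx j (v a)) x y * pullback Inr E2 x y"
      "dx (Inr l) (G (Inr k)) x y = pullback Inr (dx l (energy_spray E2 k)) x y"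
proof -
  have z: "pullback Inl (dy j (v a)) x y = 0" by (simp add: pullback_def)
  show "dy (Inl j) (G (Inl a)) x y = pullback Inl (dy j (energy_spray E1 a)) x y"
      "dy (Inr l) (G (Inl a)) x y = pullback Inl (v a) x y * pullback Inr (dy l E2) x y"
      "dy (Inl j) (G (Inr k)) x y = pullback Inl (dy j \<phi>) x y * y $ Inr k"
      "dy (Inr l) (G (Inr k)) x y = pullback Inr (dy l (energy_spray E2 k)) x y + (if l = k then pullback Inl \<phi> x y else 0)"
      "dx (Inl j) (G (Inl a)) x y = pullback Inl (dx j (energy_spray E1 a)) x y + pullback Inl (dx j (v a)) x y * pullback Inr E2 x y"
      "dx (Inr l) (G (Inr k)) x y = pullback Inr (dx l (energy_spray E2 k)) x y"
    unfolding G_def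
    by (simp_all add: dx_add[OF _ _ xy] dx_mult[OF _ _ xy] dy_add[OF _ _ xy] dy_mult[OF _ _ xy] smooth_W'
        dx_pullback_W[OF xy] dy_pullback_W[OF xy] z)
qed

text \<open>Only second derivatives starting from a diagonal term \<open>dy i (G i)\<close> occur in
  the trace. Each fiber index \<open>k\<close> contributes one copy of \<open>\<phi>\<close>, which
  is the source of the factor \<open>CARD('n)\<close> in the curvature formula.\<close>

lemma
  assumes xy: "(x, y) \<in> W"
  shows dx_dy_G_Inl: "dx (Inl j) (dy (Inl a) (G (Inl a))) x y = pullback Inl (dx j (dy a (energy_spray E1 a))) x y"
      "dx (Inr l) (dy (Inl a) (G (Inl a))) x y = 0"
    and dy_dy_G_Inl: "dy (Inl j) (dy (Inl a) (G (Inl a))) x y = pullback Inl (dy j (dy a (energy_spray E1 a))) x y"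
      "dy (Inr l) (dy (Inl a) (G (Inl a))) x y = 0"
    and dx_dy_G_Inr: "dx (Inl j) (dy (Inr k) (G (Inr k))) x y = pullback Inl (dx j \<phi>) x y"
      "dx (Inr l) (dy (Inr k) (G (Inr k))) x y = pullback Inr (dx l (dy k (energy_spray E2 k))) x y"
    and dy_dy_G_Inr: "dy (Inl j) (dy (Inr k) (G (Inr k))) x y = pullback Inl (dy j \<phi>) x y"
      "dy (Inr l) (dy (Inr k) (G (Inr k))) x y = pullback Inr (dy l (dy k (energy_spray E2 k))) x y"
proof -
  have s: "smooth2 W (pullback Inl (dy a (energy_spray E1 a)))"
    "smooth2 W (\<lambda>x y. pullback Inr (dy k (energy_spray E2 k)) x y + pullback Inl \<phi> x y)"
    by (intro smooth_W')+
  have c2: "dy (Inr k) (G (Inr k)) x y = pullback Inr (dy k (energy_spray E2 k)) x y + pullback Inl \<phi> x y"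
    if "(x, y) \<in> W" for x y
    using dy_G_Inr(2)[OF that] by simp
  note c = dx_cong[OF open_W xy s(1) dy_G_Inl(1)] dy_cong[OF open_W xy s(1) dy_G_Inl(1)]
    dx_cong[OF open_W xy s(2) c2] dy_cong[OF open_W xy s(2) c2]
  show "dx (Inl j) (dy (Inl a) (G (Inl a))) x y = pullback Inl (dx j (dy a (energy_spray E1 a))) x y"
      "dx (Inr l) (dy (Inl a) (G (Inl a))) x y = 0"
      "dy (Inl j) (dy (Inl a) (G (Inl a))) x y = pullback Inl (dy j (dy a (energy_spray E1 a))) x y"
      "dy (Inr l) (dy (Inl a) (G (Inl a))) x y = 0"
      "dx (Inl j) (dy (Inr k) (G (Inr k))) x y = pullback Inl (dx j \<phi>) x y"
      "dx (Inr l) (dy (Inr k) (G (Inr k))) x y = pullback Inr (dx l (dy k (energy_spray E2 k))) x y"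
      "dy (Inl j) (dy (Inr k) (G (Inr k))) x y = pullback Inl (dy j \<phi>) x y"
      "dy (Inr l) (dy (Inr k) (G (Inr k))) x y = pullback Inr (dy l (dy k (energy_spray E2 k))) x y"
    by (simp_all add: c dx_add[OF _ _ xy] dy_add[OF _ _ xy] smooth_W' dx_pullback_W[OF xy] dy_pullback_W[OF xy])
qed

text \<open>At a critical point of \<open>F\<close> the Christoffel terms of the Hessian drop out,
  and this is half the Laplacian of \<open>F\<close> with respect to the base metric.\<close>

definition A :: "real^'m \<Rightarrow> real" where
  "A x = 1/2 * (\<Sum>a\<in>UNIV. \<Sum>l\<in>UNIV. matrix_inv (b x) $ a $ l * dx a (dx l (\<lambda>x y. F x)) x 0)"

context
  fixes x0 assumes x0: "x0 \<in> U" and crit: "\<And>l. dx l (\<lambda>x y. F x) x0 0 = 0"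
begin

text \<open>In the product rule the derivative of the inverse matrix is multiplied by
  \<open>dF\<close>, which vanishes at \<open>x0\<close>; the factor \<open>- 1/4\<close> in
  \<open>v\<close> meets the \<open>1/2\<close> in \<open>A\<close>.\<close>

lemma dx_v_crit: "(\<Sum>a\<in>UNIV. dx a (v a) x0 y) = - A x0 / 2"
proof -
  have xy: "(x0, y) \<in> WU" using x0 by simp
  have s: "smooth2 WU (\<lambda>x y. matrix_inv (b x) $ a $ l)" for a l
    using inv_b by (intro smooth2_matrix_inv open_WU smooth2_WU_fst smooth_b) auto
  have s2: "smooth2 WU (\<lambda>x y. \<Sum>l\<in>UNIV. matrix_inv (b x) $ a $ l * dx l (\<lambda>x y. F x) x 0)" for a
    by (intro smooth2_intros open_WU s smooth_dF)
  have "dx a (v a) x0 y = - 1/4 * (\<Sum>l\<in>UNIV. matrix_inv (b x0) $ a $ l * dx a (\<lambda>x y. dx l (\<lambda>x y. F x) x 0) x0 y)" for a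
    unfolding v_def[abs_def] dx_cmult[OF s2 xy]
    by (simp add: dx_sum[OF open_WU _ xy] dx_mult[OF _ _ xy] smooth2_mult[OF open_WU] s smooth_dF crit)
  then have "(\<Sum>a\<in>UNIV. dx a (v a) x0 y) =
      - 1/4 * (\<Sum>a\<in>UNIV. \<Sum>l\<in>UNIV. matrix_inv (b x0) $ a $ l * dx a (dx l (\<lambda>x y. F x)) x0 0)"
    by (simp add: dx_def[of _ "\<lambda>x y. dx _ _ x 0"] dx_def[of _ "dx _ _"] sum_distrib_left)
  then show ?thesis by (simp add: A_def)
qed

text \<open>At \<open>x0\<close> every term containing an undifferentiated \<open>v\<close> or
  \<open>\<phi>\<close>, or a velocity derivative of \<open>\<phi>\<close>, is zero. The divergence
  of \<open>v\<close> remains in \<open>2 * dx i (G i)\<close> with factor \<open>E2\<close>, and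
  the position derivative of \<open>\<phi>\<close> remains in
  \<open>y $ j * dx j (dy i (G i))\<close>, once for each fiber index.\<close>

lemma spray_ricci_crit:
  assumes "x2 \<in> V" "y2 \<noteq> 0"
  shows "spray_ricci (energy_spray E) (vec_join x0 x2) (vec_join y1 y2) =
      spray_ricci (energy_spray E1) x0 y1 + spray_ricci (energy_spray E2) x2 y2 - A x0 * E2 x2 y2
      - CARD('n) * (\<Sum>j\<in>UNIV. y1 $ j * dx j \<phi> x0 y1)"
proof -
  have xy: "(vec_join x0 x2, vec_join y1 y2) \<in> W"
    using assms x0 by (simp add: W_def)
  have v0: "v a x0 y = 0" and p0: "\<phi> x0 y = 0" for a y
    by (simp_all add: v_def \<phi>_def crit)
  \<comment> \<open>At the fixed position \<open>x0\<close> the function \<open>\<phi>\<close>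
    vanishes for all velocities, so its velocity derivatives vanish there too; its position
    derivatives need not.\<close>
  have "\<phi> x0 = (\<lambda>y. 0)" using p0 by auto
  then have dp0: "dy j \<phi> x0 y = 0" for j y
    by (simp add: dy_def)
  have G0: "G (Inl a) (vec_join x0 x2) (vec_join y1 y2) = energy_spray E1 a x0 y1"
    "G (Inr k) (vec_join x0 x2) (vec_join y1 y2) = energy_spray E2 k x2 y2" for a k
    by (simp_all add: G_def pullback_def v0 p0)
  have yn: "vec_join y1 y2 $ Inl a = y1 $ a" "vec_join y1 y2 $ Inr k = y2 $ k" for a k
    by (simp_all add: vec_join_def)
  have dG: "dy (Inr l) (G (Inr k)) (vec_join x0 x2) (vec_join y1 y2) = dy l (energy_spray E2 k) x2 y2" for l k
    by (simp add: dy_G_Inr[OF xy] pullback_def p0)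
  have "spray_ricci (energy_spray E) (vec_join x0 x2) (vec_join y1 y2) =
      spray_ricci G (vec_join x0 x2) (vec_join y1 y2)"
    by (rule spray_ricci_cong[OF open_W smooth_G energy_spray_eq_G xy])
  also have "\<dots> = spray_ricci (energy_spray E1) x0 y1 + spray_ricci (energy_spray E2) x2 y2
      + 2 * (\<Sum>a\<in>UNIV. dx a (v a) x0 y1) * E2 x2 y2
      - CARD('n) * (\<Sum>j\<in>UNIV. y1 $ j * dx j \<phi> x0 y1)"
    unfolding spray_ricci_def sum_UNIV_Plus
    by (simp add: dx_G[OF xy] dy_G_Inl[OF xy] dy_G_Inr(1)[OF xy] dG dx_dy_G_Inl[OF xy]
        dy_dy_G_Inl[OF xy] dx_dy_G_Inr[OF xy] dy_dy_G_Inr[OF xy] G0 yn pullback_def v0 dp0)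
      (simp add: sum.distrib sum_subtractf sum_distrib_left sum_distrib_right algebra_simps)
  finally show ?thesis by (simp add: dx_v_crit)
qed

text \<open>\<open>c\<close> is the same for all velocities. Moving everything that involves
  \<open>y1\<close> to one side gives \<open>H\<close>, whose value at nonzero vectors is fixed by
  the fiber data, although \<open>H\<close> has degree 2.\<close>

lemma einstein_fibre:
  assumes x2: "x2 \<in> V"
    and ein: "\<And>y1 y2. y1 \<noteq> 0 \<Longrightarrow> y2 \<noteq> 0 \<Longrightarrow>
      spray_ricci (energy_spray E) (vec_join x0 x2) (vec_join y1 y2) = c * E (vec_join x0 x2) (vec_join y1 y2)"
    and y2: "y2 \<noteq> 0"
  shows "spray_ricci (energy_spray E2) x2 y2 = (c * F x0 + A x0) * E2 x2 y2"
proof -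
  define H where "H y = spray_ricci (energy_spray E1) x0 y - CARD('n) * (\<Sum>j\<in>UNIV. y $ j * dx j \<phi> x0 y)
      - c * E1 x0 y" for y
  have H: "H y = (c * F x0 + A x0) * E2 x2 y2 - spray_ricci (energy_spray E2) x2 y2" if "y \<noteq> 0" for y
    using ein[OF that y2] spray_ricci_crit[OF x2 y2, of y]
    by (simp add: H_def E_def pullback_def algebra_simps)
  have hE1: "homogeneous WU 2 E1"
    by (simp add: homogeneous_def E1_def sum_distrib_left power2_eq_square algebra_simps)
  have hp: "homogeneous WU 1 \<phi>"
    by (simp add: homogeneous_def \<phi>_def sum_distrib_left algebra_simps)
  have "H (2 *\<^sub>R y) = 4 * H y" for y
  proof -
    have xy: "(x0, y) \<in> WU" using x0 by simp
    have "spray_ricci (energy_spray E1) x0 (2 *\<^sub>R y) = 4 * spray_ricci (energy_spray E1) x0 y"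
      using homogeneousD[OF homogeneous_spray_ricci[OF open_WU conic_WU smooth_spray_E1
          homogeneous_energy_spray[OF open_WU conic_WU smooth2_E1 hE1]] xy, of 2] by simp
    moreover have "dx j \<phi> x0 (2 *\<^sub>R y) = 2 * dx j \<phi> x0 y" for j
      using homogeneousD[OF homogeneous_dx[OF open_WU conic_WU smooth_\<phi> hp] xy, of 2] by simp
    moreover have "E1 x0 (2 *\<^sub>R y) = 4 * E1 x0 y"
      using homogeneousD[OF hE1 xy, of 2] by simp
    ultimately show ?thesis
      by (simp add: H_def sum_distrib_left algebra_simps)
  qed
  \<comment> \<open>An arbitrary nonzero vector and its double: \<open>H\<close> takes the same
    value at both, while the second value is four times the first, so it is
    \<open>0\<close>.\<close>
  from this[of "axis undefined 1"] H[of "axis undefined 1"] H[of "2 *\<^sub>R axis undefined 1"]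
  show ?thesis by (simp add: axis_eq_0_iff)
qed

end

end

section \<open>The Hessian at a minimum\<close>

lemma sum_insert_insert:
  fixes f :: "'i \<Rightarrow> 'i \<Rightarrow> 'c::comm_monoid_add"
  assumes "finite I" "k \<notin> I"
  shows "(\<Sum>i\<in>insert k I. \<Sum>j\<in>insert k I. f i j) =
    f k k + (\<Sum>j\<in>I. f k j) + (\<Sum>i\<in>I. f i k) + (\<Sum>i\<in>I. \<Sum>j\<in>I. f i j)"
  using assms by (simp add: sum.distrib ac_simps)

text \<open>The index set is exhausted by taking Schur complements of \<open>H\<close>, each of which splits off
  a rank one matrix.\<close>

lemma trace_mult_nonneg:
  fixes P H :: "'i \<Rightarrow> 'i \<Rightarrow> real"
  assumes "finite I" "\<And>i j. P i j = P j i" "\<And>i j. H i j = H j i"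
    and "\<And>u. 0 \<le> (\<Sum>i\<in>I. \<Sum>j\<in>I. P i j * (u i * u j))"
    and "\<And>u. 0 \<le> (\<Sum>i\<in>I. \<Sum>j\<in>I. H i j * (u i * u j))"
  shows "0 \<le> (\<Sum>i\<in>I. \<Sum>j\<in>I. P i j * H i j)"
  using assms
proof (induction I arbitrary: H rule: finite_induct)
  case (insert k I)
  note ins = sum_insert_insert[OF insert.hyps]
  have symP: "P i j = P j i" and symH: "H i j = H j i" for i j
    using insert.prems by auto
  have symHk: "H k j = H j k" if "j \<in> I" for j
    by (rule symH)
  \<comment> \<open>The Schur complement with respect to index \<open>k\<close>. If
    \<open>H k k = 0\<close>, division by zero yields \<open>0\<close> and \<open>H'\<close> is
    \<open>H\<close>, so the induction step below covers both cases.\<close>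
  define H' where "H' i j = H i j - H i k * H j k / H k k" for i j
  have Hk0: "H k k \<ge> 0"
    using insert.prems(4)[of "\<lambda>i. if i = k then 1 else 0"] insert.hyps
    by (simp add: if_distrib[of "\<lambda>c. _ * c"] cong: if_cong)
  have restr: "0 \<le> (\<Sum>i\<in>I. \<Sum>j\<in>I. Q i j * (u i * u j))"
    if "\<And>u. 0 \<le> (\<Sum>i\<in>insert k I. \<Sum>j\<in>insert k I. Q i j * (u i * u j))" for Q :: "'i \<Rightarrow> 'i \<Rightarrow> real" and u
  proof -
    have "(\<Sum>i\<in>I. \<Sum>j\<in>I. Q i j * ((u(k := 0)) i * (u(k := 0)) j)) = (\<Sum>i\<in>I. \<Sum>j\<in>I. Q i j * (u i * u j))"
      using insert.hyps by (intro sum.cong) auto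
    then show ?thesis
      using that[of "u(k := 0)"] by (simp only: ins) simp
  qed
  \<comment> \<open>The quadratic form of \<open>H\<close> with component \<open>k\<close> set to
    \<open>t\<close>, read as a polynomial in \<open>t\<close>.\<close>
  have expand: "0 \<le> H k k * (t * t) + 2 * t * (\<Sum>i\<in>I. H i k * u i) + (\<Sum>i\<in>I. \<Sum>j\<in>I. H i j * (u i * u j))" for t u
  proof -
    have "(\<Sum>i\<in>I. \<Sum>j\<in>I. H i j * ((u(k := t)) i * (u(k := t)) j)) = (\<Sum>i\<in>I. \<Sum>j\<in>I. H i j * (u i * u j))"
      "(\<Sum>i\<in>I. H i k * ((u(k := t)) i * (u(k := t)) k)) = t * (\<Sum>i\<in>I. H i k * u i)"
      "(\<Sum>i\<in>I. H k i * ((u(k := t)) k * (u(k := t)) i)) = t * (\<Sum>i\<in>I. H i k * u i)"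
      using insert.hyps by (auto intro!: sum.cong simp: sum_distrib_left symHk)
    then show ?thesis
      using insert.prems(4)[of "u(k := t)"] by (simp only: ins) simp
  qed
  have "0 \<le> (\<Sum>i\<in>I. \<Sum>j\<in>I. P i j * H' i j)"
  proof (rule insert.IH)
    show "0 \<le> (\<Sum>i\<in>I. \<Sum>j\<in>I. H' i j * (u i * u j))" for u
    proof -
      define s where "s = (\<Sum>i\<in>I. H i k * u i)"
      have "(\<Sum>i\<in>I. \<Sum>j\<in>I. H' i j * (u i * u j)) = (\<Sum>i\<in>I. \<Sum>j\<in>I. H i j * (u i * u j)) - s * s / H k k"
        by (simp add: H'_def s_def sum_product sum_divide_distrib algebra_simps sum_subtractf)
      \<comment> \<open>\<open>t = - s / H k k\<close> minimises that polynomial when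
        \<open>H k k > 0\<close>, and the minimum is the form of \<open>H'\<close>. For
        \<open>H k k = 0\<close> this \<open>t\<close> is \<open>0\<close> and the identity still
        holds.\<close>
      also have "\<dots> = H k k * (- s / H k k * (- s / H k k)) + 2 * (- s / H k k) * s + (\<Sum>i\<in>I. \<Sum>j\<in>I. H i j * (u i * u j))"
        by (cases "H k k = 0") (simp_all add: field_simps)
      finally show ?thesis using expand[of "- s / H k k" u] by (simp add: s_def)
    qed
    show "H' i j = H' j i" for i j using symH[of i j] by (simp add: H'_def)
  qed (use symP restr[OF insert.prems(3)] in auto)
  show ?case
  proof (cases "H k k = 0")
    case True
    have "H i k = 0" if i: "i \<in> I" for i
    proof (rule ccontr)
      assume n: "H i k \<noteq> 0"
      \<comment> \<open>With a zero diagonal entry the polynomial is affine in \<open>t\<close>;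
        being bounded below it must have slope zero. The value of \<open>t\<close> used next would
        make it equal to \<open>-1\<close>.\<close>
      have *: "0 \<le> 2 * t * H i k + H i i" for t
        using expand[of t "\<lambda>j. if j = i then 1 else 0"] i insert.hyps(1) True
        by (simp add: if_distrib[of "\<lambda>c. _ * c"] cong: if_cong)
      show False
        using *[of "- (H i i + 1) / (2 * H i k)"] n by (simp add: field_simps)
    qed
    then have "(\<Sum>i\<in>I. \<Sum>j\<in>I. P i j * H' i j) = (\<Sum>i\<in>insert k I. \<Sum>j\<in>insert k I. P i j * H i j)"
      using True symHk by (simp add: ins H'_def)
    with \<open>0 \<le> (\<Sum>i\<in>I. \<Sum>j\<in>I. P i j * H' i j)\<close> show ?thesis by simp
  next
    case False
    have z: "H' i k = 0" "H' k i = 0" for i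
      using False symH[of k i] by (simp_all add: H'_def)
    \<comment> \<open>The part split off has rank one, so its pairing with \<open>P\<close> is the
      form of \<open>P\<close> at column \<open>k\<close> of \<open>H\<close>, divided by
      \<open>H k k > 0\<close>.\<close>
    have "(\<Sum>i\<in>insert k I. \<Sum>j\<in>insert k I. P i j * H i j) =
        (\<Sum>i\<in>insert k I. \<Sum>j\<in>insert k I. P i j * H' i j) +
        (\<Sum>i\<in>insert k I. \<Sum>j\<in>insert k I. P i j * (H i k * H j k)) / H k k"
      by (simp add: H'_def algebra_simps sum_divide_distrib flip: sum.distrib del: sum.insert)
    moreover have "(\<Sum>i\<in>insert k I. \<Sum>j\<in>insert k I. P i j * H' i j) = (\<Sum>i\<in>I. \<Sum>j\<in>I. P i j * H' i j)"
      by (simp only: ins z) simp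
    ultimately show ?thesis
      using \<open>0 \<le> (\<Sum>i\<in>I. \<Sum>j\<in>I. P i j * H' i j)\<close> insert.prems(3)[of "\<lambda>i. H i k"] Hk0 by simp
  qed
qed simp

text \<open>Restrict \<open>h\<close> to the line through \<open>x0\<close> in direction
  \<open>w\<close>. A negative second derivative would make the first derivative, which is zero at
  the minimum, negative just after it, and \<open>h\<close> would fall below its minimal
  value.\<close>

lemma
  fixes h :: "'e::real_normed_vector \<Rightarrow> real"
  assumes "open U" "x0 \<in> U" "smooth_on h U" "\<And>x. x \<in> U \<Longrightarrow> h x0 \<le> h x"
  shows frechet_derivative_min: "frechet_derivative h (at x0) = (\<lambda>w. 0)"
    and second_derivative_min: "0 \<le> frechet_derivative (\<lambda>x. frechet_derivative h (at x) w) (at x0) w"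
proof -
  have D: "(h has_derivative frechet_derivative h (at x)) (at x)" if "x \<in> U" for x
    using smooth_on_imp_differentiable[OF assms(3) that] by (simp add: frechet_derivative_works)
  have "eventually (\<lambda>x. x \<in> U) (at x0)"
    using assms(1,2) eventually_at_topological by blast
  then show D0: "frechet_derivative h (at x0) = (\<lambda>w. 0)"
    by (intro has_derivative_local_min[OF D[OF assms(2)]]) (auto elim: eventually_mono intro: assms(4))
  define c where "c = frechet_derivative (\<lambda>x. frechet_derivative h (at x) w) (at x0) w"
  define p where "p t = h (x0 + t *\<^sub>R w)" for t :: real
  define p' where "p' t = frechet_derivative h (at (x0 + t *\<^sub>R w)) w" for t :: real
  have line: "((\<lambda>t::real. x0 + t *\<^sub>R w) has_derivative (\<lambda>t. t *\<^sub>R w)) (at t)" for t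
    by (auto intro!: derivative_eq_intros)
  have "open ((\<lambda>t::real. x0 + t *\<^sub>R w) -` U)"
    using assms(1) by (intro open_vimage) (auto intro!: continuous_intros)
  then obtain e where "e > 0" "ball 0 e \<subseteq> (\<lambda>t::real. x0 + t *\<^sub>R w) -` U"
    using assms(2) by (auto elim!: openE[where x = 0])
  then have e: "e > 0" "\<And>t::real. \<bar>t\<bar> < e \<Longrightarrow> x0 + t *\<^sub>R w \<in> U"
    by auto
  have p: "(p has_real_derivative p' t) (at t)" if "\<bar>t\<bar> < e" for t
  proof -
    have "linear (frechet_derivative h (at (x0 + t *\<^sub>R w)))"
      using D[OF e(2)[OF that]] by (rule has_derivative_linear)
    then show ?thesis
      using has_derivative_compose[OF line D[OF e(2)[OF that]]]
      by (simp add: has_field_derivative_def p_def[abs_def] p'_def linear_cmul mult_commute_abs)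
  qed
  let ?D = "frechet_derivative (\<lambda>x. frechet_derivative h (at x) w) (at x0)"
  have D2: "((\<lambda>x. frechet_derivative h (at x) w) has_derivative ?D) (at x0)"
    using smooth_on_imp_differentiable[OF smooth_on_frechet_derivative[OF assms(3)] assms(2)]
    by (simp add: frechet_derivative_works)
  have "(p' has_derivative (\<lambda>t. ?D (t *\<^sub>R w))) (at 0)"
    unfolding p'_def[abs_def] by (rule has_derivative_compose[OF line]) (simp add: D2)
  then have p': "(p' has_real_derivative c) (at 0)"
    by (simp add: has_field_derivative_def c_def linear_cmul[OF has_derivative_linear[OF D2]] mult_commute_abs)
  show "0 \<le> frechet_derivative (\<lambda>x. frechet_derivative h (at x) w) (at x0) w"
  proof (rule ccontr)
    assume "\<not> ?thesis"
    then have "c < 0" by (simp add: c_def)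
    from DERIV_neg_dec_right[OF p' this]
    obtain d where d: "d > 0" "\<And>t. t > 0 \<Longrightarrow> t < d \<Longrightarrow> p' t < p' 0" by auto
    \<comment> \<open>Small enough that on \<open>(0, r]\<close> the derivative \<open>p'\<close> is
      negative and the segment stays in \<open>U\<close>.\<close>
    define r where "r = min d e / 2"
    have r: "r > 0" "r < d" "r < e" using d(1) e(1) by (auto simp: r_def)
    have "p' 0 = 0" by (simp add: p'_def D0)
    then have neg: "p' t < 0" if "0 < t" "t \<le> r" for t using d(2)[of t] that r by simp
    have "p r < p 0"
    proof (rule DERIV_neg_imp_decreasing_open[OF r(1)])
      show "\<exists>y. (p has_real_derivative y) (at t) \<and> y < 0" if "0 < t" "t < r" for t
        using p[of t] neg[of t] that r by force
      show "continuous_on {0..r} p"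
        using r by (intro continuous_at_imp_continuous_on ballI DERIV_isCont[OF p]) auto
    qed
    moreover have "p 0 \<le> p r"
      using assms(4)[OF e(2)[of r]] r by (simp add: p_def)
    ultimately show False by simp
  qed
qed

context warped_energy
begin

text \<open>\<open>A\<close> is half the trace of the product of two positive semidefinite forms:
  the inverse of \<open>b\<close>, and the Hessian of \<open>F\<close> at a minimum.\<close>

lemma A_nonneg:
  assumes x0: "x0 \<in> U" and min: "\<And>x. x \<in> U \<Longrightarrow> F x0 \<le> F x"
    and pos: "\<And>u. 0 \<le> (\<Sum>i\<in>UNIV. \<Sum>j\<in>UNIV. b x0 $ i $ j * (u $ i * u $ j))"
  shows "0 \<le> A x0"
proof -
  let ?P = "matrix_inv (b x0)"
  define H where "H a l = dx a (dx l (\<lambda>x y. F x)) x0 0" for a l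
  have sb: "transpose (b x0) = b x0"
    using sym_b[OF x0] by (simp add: transpose_def vec_eq_iff)
  have "b x0 ** transpose ?P = transpose (?P ** b x0)"
    by (simp add: matrix_transpose_mul sb)
  also have "\<dots> = mat 1"
    by (simp add: matrix_inv_left[OF inv_b[OF x0]] transpose_mat)
  finally have "?P = transpose ?P" by (rule matrix_inv_unique)
  then have symP: "?P $ i $ j = ?P $ j $ i" for i j
    by (subst (asm) vec_eq_iff) (simp add: transpose_def vec_eq_iff)
  \<comment> \<open>Substituting \<open>u = b w\<close> turns the form of the inverse at
    \<open>u\<close> into the form of \<open>b\<close> at \<open>w\<close>.\<close>
  have P: "0 \<le> (\<Sum>i\<in>UNIV. \<Sum>j\<in>UNIV. ?P $ i $ j * (u i * u j))" for u
  proof -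
    define w where "w = ?P *v (\<chi> i. u i)"
    have w: "(\<Sum>j\<in>UNIV. ?P $ i $ j * u j) = w $ i" for i
      by (simp add: w_def matrix_vector_mult_def)
    have "b x0 *v w = (\<chi> i. u i)"
      by (simp add: w_def matrix_vector_mul_assoc matrix_inv_right[OF inv_b[OF x0]])
    then have u: "u i = (\<Sum>j\<in>UNIV. b x0 $ i $ j * w $ j)" for i
      by (simp add: matrix_vector_mult_def vec_eq_iff)
    have "(\<Sum>i\<in>UNIV. \<Sum>j\<in>UNIV. ?P $ i $ j * (u i * u j)) = (\<Sum>i\<in>UNIV. u i * (\<Sum>j\<in>UNIV. ?P $ i $ j * u j))"
      by (simp add: sum_distrib_left algebra_simps)
    also have "\<dots> = (\<Sum>i\<in>UNIV. u i * w $ i)" by (simp add: w)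
    also have "\<dots> = (\<Sum>i\<in>UNIV. \<Sum>j\<in>UNIV. b x0 $ i $ j * (w $ i * w $ j))"
      by (simp add: u sum_distrib_left sum_distrib_right algebra_simps)
    finally show ?thesis using pos by simp
  qed
  have Hq: "(\<Sum>i\<in>UNIV. \<Sum>j\<in>UNIV. H i j * (u i * u j)) \<ge> 0" for u
  proof -
    let ?w = "\<chi> i. u i"
    have sF: "smooth_on (\<lambda>x. frechet_derivative F (at x) w) U" for w
      by (rule smooth_on_frechet_derivative[OF smooth_F])
    have lin: "linear (frechet_derivative F (at x))" if "x \<in> U" for x
      by (rule linear_frechet_derivative[OF smooth_on_imp_differentiable[OF smooth_F that]])
    have lin2: "linear (frechet_derivative (\<lambda>x. frechet_derivative F (at x) w) (at x0))" for w
      by (rule linear_frechet_derivative[OF smooth_on_imp_differentiable[OF sF x0]])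
    have 1: "dx j (dx i (\<lambda>x y. F x)) x0 0 = frechet_derivative (\<lambda>x. frechet_derivative F (at x) (axis i 1)) (at x0) (axis j 1)" for i j
      by (simp add: dx_def)
    \<comment> \<open>Near \<open>x0\<close> the derivative of \<open>F\<close> in direction
      \<open>?w\<close> is this combination of partial derivatives, so the second derivative along
      \<open>?w\<close> becomes the quadratic form of \<open>H\<close>.\<close>
    have "((\<lambda>x. \<Sum>i\<in>UNIV. u i * frechet_derivative F (at x) (axis i 1)) has_derivative
        (\<lambda>w. \<Sum>i\<in>UNIV. u i * frechet_derivative (\<lambda>x. frechet_derivative F (at x) (axis i 1)) (at x0) w)) (at x0)"
      using smooth_on_imp_differentiable[OF sF x0]
      by (intro has_derivative_sum has_derivative_mult_right) (simp add: frechet_derivative_works)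
    then have "((\<lambda>x. frechet_derivative F (at x) ?w) has_derivative
        (\<lambda>w. \<Sum>i\<in>UNIV. u i * frechet_derivative (\<lambda>x. frechet_derivative F (at x) (axis i 1)) (at x0) w)) (at x0)"
      by (rule has_derivative_transform_within_open[OF _ open_U x0])
        (subst linear_expand_axis[OF lin, of _ ?w], auto)
    from fun_cong[OF frechet_derivative_at[OF this], of ?w] second_derivative_min[OF open_U x0 smooth_F min, of ?w]
    have "0 \<le> (\<Sum>i\<in>UNIV. u i * frechet_derivative (\<lambda>x. frechet_derivative F (at x) (axis i 1)) (at x0) ?w)"
      by simp
    also have "\<dots> = (\<Sum>i\<in>UNIV. \<Sum>j\<in>UNIV. H j i * (u j * u i))"
      by (subst linear_expand_axis[OF lin2, of _ ?w]) (simp add: sum_distrib_left H_def 1 algebra_simps)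
    finally show ?thesis by (subst (asm) sum.swap)
  qed
  \<comment> \<open>Symmetrising the Hessian provides the symmetry that
    \<open>trace_mult_nonneg\<close> asks for and, as \<open>?P\<close> is symmetric, doubles the
    trace, whence \<open>4 * A x0\<close>.\<close>
  have "0 \<le> (\<Sum>i\<in>UNIV. \<Sum>j\<in>UNIV. ?P $ i $ j * (H i j + H j i))"
  proof (rule trace_mult_nonneg)
    show "0 \<le> (\<Sum>i\<in>UNIV. \<Sum>j\<in>UNIV. (H i j + H j i) * (u i * u j))" for u
    proof -
      have "(\<Sum>i\<in>UNIV. \<Sum>j\<in>UNIV. H j i * (u i * u j)) = (\<Sum>i\<in>UNIV. \<Sum>j\<in>UNIV. H i j * (u i * u j))"
        by (subst sum.swap) (simp add: mult.commute)
      then show ?thesis using Hq[of u] by (simp add: distrib_right sum.distrib)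
    qed
  qed (use symP P in auto)
  also have "\<dots> = 4 * A x0"
  proof -
    have "(\<Sum>i\<in>UNIV. \<Sum>j\<in>UNIV. ?P $ i $ j * H j i) = (\<Sum>i\<in>UNIV. \<Sum>j\<in>UNIV. ?P $ i $ j * H i j)"
      by (subst sum.swap) (simp add: symP)
    then show ?thesis by (simp add: A_def H_def distrib_left sum.distrib)
  qed
  finally show ?thesis by simp
qed

end

section \<open>Charts and tangent vectors of products\<close>

definition chart_overlap :: "('a, 'n::finite) chart \<Rightarrow> ('a, 'n) chart \<Rightarrow> (real^'n) set" where
  "chart_overlap c d = snd c ` (fst c \<inter> fst d)"

text \<open>What the chain rule between charts requires of an atlas, in a form that passes easily to
  products.\<close>

definition differentiable_atlas :: "('a, 'n::finite) mfd \<Rightarrow> bool" where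
  "differentiable_atlas M \<longleftrightarrow>
     (\<forall>c\<in>atlas M. fst c \<subseteq> topspace (mtop M) \<and> inj_on (snd c) (fst c) \<and> open (chart_image c)) \<and>
     (\<forall>c\<in>atlas M. \<forall>d\<in>atlas M. open (chart_overlap c d) \<and>
        (\<forall>x\<in>chart_overlap c d. transition c d differentiable (at x)))"

lemma smooth_manifold_imp_differentiable_atlas:
  assumes "smooth_manifold M"
  shows "differentiable_atlas M"
proof -
  have hom: "homeomorphic_map (subtopology (mtop M) (fst c)) (top_of_set (chart_image c)) (snd c)"
    and op: "openin (mtop M) (fst c)" "open (chart_image c)" if "c \<in> atlas M" for c
    using assms that by (auto simp: smooth_manifold_def)
  have "inj_on (snd c) (fst c)" if "c \<in> atlas M" for c
    using homeomorphic_imp_injective_map[OF hom[OF that]] openin_subset[OF op(1)[OF that]]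
    by (simp add: topspace_subtopology Int_absorb1)
  moreover have "open (chart_overlap c d)" if "c \<in> atlas M" "d \<in> atlas M" for c d
  proof -
    have "openin (subtopology (mtop M) (fst c)) (fst c \<inter> fst d)"
      using op(1)[OF that(2)] by (auto simp: openin_subtopology)
    then have "openin (top_of_set (chart_image c)) (chart_overlap c d)"
      using homeomorphic_imp_open_map[OF hom[OF that(1)]] unfolding open_map_def chart_overlap_def by blast
    then show ?thesis
      using op(2)[OF that(1)] openin_open_eq by blast
  qed
  moreover have "transition c d differentiable (at x)"
    if "c \<in> atlas M" "d \<in> atlas M" "x \<in> chart_overlap c d" for c d x
    using assms that smooth_on_imp_differentiable[of "transition c d" "chart_overlap c d"]
    by (auto simp: smooth_manifold_def chart_overlap_def)
  ultimately show ?thesis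
    using op openin_subset unfolding differentiable_atlas_def by blast
qed

lemma chart_inv_props:
  assumes "inj_on (snd c) (fst c)"
  shows "p \<in> fst c \<Longrightarrow> chart_inv c (snd c p) = p"
    and "x \<in> chart_image c \<Longrightarrow> chart_inv c x \<in> fst c"
    and "x \<in> chart_image c \<Longrightarrow> snd c (chart_inv c x) = x"
  using assms by (auto simp: chart_inv_def chart_image_def f_inv_into_f inv_into_into)

lemma in_chart_overlap_iff:
  "inj_on (snd c) (fst c) \<Longrightarrow> x \<in> chart_overlap c d \<longleftrightarrow> x \<in> chart_image c \<and> chart_inv c x \<in> fst d"
  by (auto simp: chart_overlap_def chart_image_def chart_inv_def)

lemma differentiable_atlasD:
  assumes "differentiable_atlas M" "c \<in> atlas M"
  shows "fst c \<subseteq> topspace (mtop M)" "inj_on (snd c) (fst c)" "open (chart_image c)"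
    and "d \<in> atlas M \<Longrightarrow> open (chart_overlap c d)"
    and "d \<in> atlas M \<Longrightarrow> x \<in> chart_overlap c d \<Longrightarrow> transition c d differentiable (at x)"
  using assms by (auto simp: differentiable_atlas_def)

section \<open>Product charts\<close>

lemma bounded_linear_vec_join_Inl: "bounded_linear (\<lambda>x. vec_join x 0)"
  and bounded_linear_vec_join_Inr: "bounded_linear (\<lambda>y. vec_join 0 y)"
  unfolding linear_conv_bounded_linear[symmetric]
  by (auto intro!: linearI simp: vec_join_def vec_eq_iff split: sum.split)

lemma vec_join_eq_add: "vec_join x y = vec_join x 0 + vec_join 0 y"
  by (auto simp: vec_join_def vec_eq_iff split: sum.split)

lemma vec_join_eq_iff: "vec_join x y = z \<longleftrightarrow> x = sub_vec Inl z \<and> y = sub_vec Inr z"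
  by (metis sub_vec_join vec_join_sub_vec)

lemma fst_prod_chart: "fst (prod_chart c d) = fst c \<times> fst d"
  and snd_prod_chart: "snd (prod_chart c d) (p, q) = vec_join (snd c p) (snd d q)"
  by (simp_all add: prod_chart_def)

lemma prod_chart_in_atlas: "c \<in> atlas M \<Longrightarrow> d \<in> atlas N \<Longrightarrow> prod_chart c d \<in> atlas (prod_mfd M N)"
  unfolding prod_mfd_def mfd.simps by blast

lemma chart_image_prod_chart:
  "z \<in> chart_image (prod_chart c d) \<longleftrightarrow> sub_vec Inl z \<in> chart_image c \<and> sub_vec Inr z \<in> chart_image d"
proof
  assume "sub_vec Inl z \<in> chart_image c \<and> sub_vec Inr z \<in> chart_image d"
  then obtain p q where pq: "p \<in> fst c" "q \<in> fst d" and z: "sub_vec Inl z = snd c p" "sub_vec Inr z = snd d q"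
    by (auto simp: chart_image_def)
  have "z = snd (prod_chart c d) (p, q)"
    unfolding snd_prod_chart z[symmetric] by simp
  with pq show "z \<in> chart_image (prod_chart c d)"
    by (auto simp: chart_image_def fst_prod_chart)
qed (auto simp: chart_image_def fst_prod_chart snd_prod_chart)

lemma inj_on_prod_chart:
  assumes "inj_on (snd c) (fst c)" "inj_on (snd d) (fst d)"
  shows "inj_on (snd (prod_chart c d)) (fst (prod_chart c d))"
  using assms by (auto simp: inj_on_def fst_prod_chart snd_prod_chart vec_join_eq_iff)

text \<open>\<open>chart_inv\<close> is defined by choice, so its value is identified by exhibiting
  a preimage and using injectivity of the chart.\<close>

lemma chart_inv_prod_chart:
  assumes "inj_on (snd c) (fst c)" "inj_on (snd d) (fst d)" "z \<in> chart_image (prod_chart c d)"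
  shows "chart_inv (prod_chart c d) z = (chart_inv c (sub_vec Inl z), chart_inv d (sub_vec Inr z))"
proof -
  let ?p = "(chart_inv c (sub_vec Inl z), chart_inv d (sub_vec Inr z))"
  have z: "sub_vec Inl z \<in> chart_image c" "sub_vec Inr z \<in> chart_image d"
    using assms(3) by (auto simp: chart_image_prod_chart)
  have "?p \<in> fst (prod_chart c d)" "snd (prod_chart c d) ?p = z"
    using chart_inv_props[OF assms(1)] chart_inv_props[OF assms(2)] z
    by (auto simp: fst_prod_chart snd_prod_chart)
  then show ?thesis
    using chart_inv_props(1)[OF inj_on_prod_chart[OF assms(1,2)]] by metis
qed

lemma chart_overlap_prod_chart:
  assumes "inj_on (snd c) (fst c)" "inj_on (snd d) (fst d)"
  shows "z \<in> chart_overlap (prod_chart c d) (prod_chart c' d') \<longleftrightarrow>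
    sub_vec Inl z \<in> chart_overlap c c' \<and> sub_vec Inr z \<in> chart_overlap d d'"
  unfolding in_chart_overlap_iff[OF inj_on_prod_chart[OF assms]] in_chart_overlap_iff[OF assms(1)]
    in_chart_overlap_iff[OF assms(2)]
  using chart_inv_prod_chart[OF assms, of z] by (auto simp: fst_prod_chart chart_image_prod_chart)

lemma open_sub_vec_vimage: "open S \<Longrightarrow> open (sub_vec j -` S)"
  by (intro open_vimage bounded_linear.continuous_on[OF bounded_linear_sub_vec] continuous_on_id)

text \<open>On an overlap of product charts the transition map is the sum of the factors' transition
  maps, each preceded by a linear projection and followed by a linear embedding.\<close>

lemma differentiable_atlas_prod_mfd:
  assumes M: "differentiable_atlas M" and N: "differentiable_atlas N"
  shows "differentiable_atlas (prod_mfd M N)"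
  unfolding differentiable_atlas_def
proof (intro conjI ballI)
  fix C assume "C \<in> atlas (prod_mfd M N)"
  then obtain c d where C: "C = prod_chart c d" "c \<in> atlas M" "d \<in> atlas N"
    by (auto simp: prod_mfd_def)
  note c = differentiable_atlasD[OF M C(2)] and d = differentiable_atlasD[OF N C(3)]
  show "fst C \<subseteq> topspace (mtop (prod_mfd M N))"
    using c(1) d(1) by (auto simp: C prod_mfd_def fst_prod_chart)
  show "inj_on (snd C) (fst C)"
    unfolding C by (rule inj_on_prod_chart[OF c(2) d(2)])
  have "chart_image C = sub_vec Inl -` chart_image c \<inter> sub_vec Inr -` chart_image d"
    by (auto simp: C chart_image_prod_chart)
  then show "open (chart_image C)"
    using c(3) d(3) by (auto intro: open_sub_vec_vimage)
  fix C' assume "C' \<in> atlas (prod_mfd M N)"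
  then obtain c' d' where C': "C' = prod_chart c' d'" "c' \<in> atlas M" "d' \<in> atlas N"
    by (auto simp: prod_mfd_def)
  have "chart_overlap C C' = sub_vec Inl -` chart_overlap c c' \<inter> sub_vec Inr -` chart_overlap d d'"
    by (auto simp: C C' chart_overlap_prod_chart[OF c(2) d(2)])
  then show op: "open (chart_overlap C C')"
    using c(4)[OF C'(2)] d(4)[OF C'(3)] by (auto intro: open_sub_vec_vimage)
  fix z assume z: "z \<in> chart_overlap C C'"
  have eq: "transition C C' z = vec_join (transition c c' (sub_vec Inl z)) 0 + vec_join 0 (transition d d' (sub_vec Inr z))"
    if "z \<in> chart_overlap C C'" for z
    using that in_chart_overlap_iff[OF inj_on_prod_chart[OF c(2) d(2)]]
    by (simp add: C C' transition_def chart_inv_prod_chart[OF c(2) d(2)] snd_prod_chart flip: vec_join_eq_add)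
  have td: "transition c c' differentiable (at (sub_vec Inl z))" "transition d d' differentiable (at (sub_vec Inr z))"
    using z chart_overlap_prod_chart[OF c(2) d(2)] c(5)[OF C'(2)] d(5)[OF C'(3)] by (auto simp: C C')
  note sd = bounded_linear_imp_differentiable[OF bounded_linear_sub_vec]
  note comp = differentiable_compose[of "transition c c'" "sub_vec Inl", OF td(1) sd]
    differentiable_compose[of "transition d d'" "sub_vec Inr", OF td(2) sd]
  have "(\<lambda>z. vec_join (transition c c' (sub_vec Inl z)) 0 + vec_join 0 (transition d d' (sub_vec Inr z)))
      differentiable (at z)"
    using differentiable_compose[of "\<lambda>x. vec_join x 0", OF bounded_linear_imp_differentiable[OF bounded_linear_vec_join_Inl] comp(1)]
      differentiable_compose[of "\<lambda>y. vec_join 0 y", OF bounded_linear_imp_differentiable[OF bounded_linear_vec_join_Inr] comp(2)]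
    by (rule differentiable_add)
  then obtain D where "((\<lambda>z. vec_join (transition c c' (sub_vec Inl z)) 0 + vec_join 0 (transition d d' (sub_vec Inr z)))
      has_derivative D) (at z)" unfolding differentiable_def by blast
  then have "(transition C C' has_derivative D) (at z)"
    by (rule has_derivative_transform_within_open[OF _ op z]) (simp add: eq)
  then show "transition C C' differentiable (at z)" by (auto simp: differentiable_def)
qed

section \<open>Tangent vectors and differentials in charts\<close>

lemma charts_atD: "c \<in> charts_at M p \<Longrightarrow> c \<in> atlas M" "c \<in> charts_at M p \<Longrightarrow> p \<in> fst c"
  by (auto simp: charts_at_def)

text \<open>Change of charts for differentials. With \<open>k\<close> a coordinate map it gives the
  compatibility condition of tangent vectors; with \<open>k\<close> built from a map
  \<open>h\<close> it shows that \<open>tangent_map\<close> does not depend on the chart.\<close>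

lemma frechet_derivative_chart_compose:
  fixes k :: "'a \<Rightarrow> 'f::real_normed_vector"
  assumes M: "differentiable_atlas M" and c: "c \<in> atlas M" "d \<in> atlas M"
    and x: "x \<in> chart_overlap c d"
    and k: "(k \<circ> chart_inv d) differentiable (at (transition c d x))"
  shows "frechet_derivative (k \<circ> chart_inv c) (at x) y =
    frechet_derivative (k \<circ> chart_inv d) (at (transition c d x)) (frechet_derivative (transition c d) (at x) y)"
proof -
  have "((k \<circ> chart_inv d) \<circ> transition c d has_derivative
      frechet_derivative (k \<circ> chart_inv d) (at (transition c d x)) \<circ> frechet_derivative (transition c d) (at x)) (at x)"
    using k differentiable_atlasD(5)[OF M c x]
    by (intro diff_chain_at) (simp_all add: frechet_derivative_works[symmetric])
  moreover have "((k \<circ> chart_inv d) \<circ> transition c d) z = (k \<circ> chart_inv c) z" if "z \<in> chart_overlap c d" for z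
    using that chart_inv_props[OF differentiable_atlasD(2)[OF M c(2)]] in_chart_overlap_iff[OF differentiable_atlasD(2)[OF M c(1)]]
    by (simp add: transition_def)
  ultimately have "(k \<circ> chart_inv c has_derivative
      frechet_derivative (k \<circ> chart_inv d) (at (transition c d x)) \<circ> frechet_derivative (transition c d) (at x)) (at x)"
    by (rule has_derivative_transform_within_open[OF _ differentiable_atlasD(4)[OF M c] x])
  from fun_cong[OF frechet_derivative_at[OF this], of y] show ?thesis by simp
qed

lemma tangent_of_in_tangent_bundle:
  assumes M: "differentiable_atlas M" and c: "c \<in> atlas M" and x: "x \<in> chart_image c"
  shows "tangent_of M c x y \<in> tangent_bundle M"
proof -
  note ci = chart_inv_props[OF differentiable_atlasD(2)[OF M c]]
  have *: "frechet_derivative (transition c e) (at x) y =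
      frechet_derivative (transition d e) (at (snd d (chart_inv c x))) (frechet_derivative (transition c d) (at x) y)"
    if "d \<in> charts_at M (chart_inv c x)" "e \<in> charts_at M (chart_inv c x)" for d e
  proof -
    have d: "d \<in> atlas M" "chart_inv c x \<in> fst d" and e: "e \<in> atlas M" "chart_inv c x \<in> fst e"
      using that by (auto simp: charts_at_def)
    have "x \<in> chart_overlap c d"
      using x d in_chart_overlap_iff[OF differentiable_atlasD(2)[OF M c]] by blast
    moreover have "transition c d x \<in> chart_overlap d e"
      using d e by (auto simp: chart_overlap_def transition_def)
    ultimately show ?thesis
      using frechet_derivative_chart_compose[OF M c d(1), of x "snd e"] differentiable_atlasD(5)[OF M d(1) e(1)]
      by (simp add: transition_def)
  qed
  let ?p = "chart_inv c x" and ?v = "snd (tangent_of M c x y)"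
  have "?v e = frechet_derivative (transition d e) (at (snd d ?p)) (?v d)"
    if d: "d \<in> charts_at M ?p" and e: "e \<in> charts_at M ?p" for d e
    unfolding tangent_of_def snd_conv if_P[OF d] if_P[OF e] by (rule *[OF d e])
  moreover have "?p \<in> topspace (mtop M)"
    using ci(2)[OF x] differentiable_atlasD(1)[OF M c] by blast
  moreover have "\<forall>d. d \<notin> charts_at M ?p \<longrightarrow> ?v d = 0"
    by (simp add: tangent_of_def)
  ultimately have "(?p, ?v) \<in> tangent_bundle M"
    unfolding tangent_bundle_def mem_Collect_eq prod.case by blast
  then show ?thesis by (simp add: tangent_of_def)
qed

lemma tangent_of_in_slit_tangent_bundle_iff:
  assumes M: "differentiable_atlas M" and c: "c \<in> atlas M" and x: "x \<in> chart_image c"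
  shows "tangent_of M c x y \<in> slit_tangent_bundle M \<longleftrightarrow> y \<noteq> 0"
proof -
  note ci = chart_inv_props[OF differentiable_atlasD(2)[OF M c]]
  have cp: "c \<in> charts_at M (chart_inv c x)" using c ci(2)[OF x] by (simp add: charts_at_def)
  \<comment> \<open>The transition from \<open>c\<close> to itself is the identity near
    \<open>x\<close>, so the component at \<open>c\<close> recovers \<open>y\<close> and a nonzero
    \<open>y\<close> gives a nonzero vector.\<close>
  have "(transition c c has_derivative (\<lambda>v. v)) (at x)"
    by (rule has_derivative_transform_within_open[OF has_derivative_ident differentiable_atlasD(3)[OF M c] x])
      (simp add: transition_def ci)
  then have id: "frechet_derivative (transition c c) (at x) y = y"
    using frechet_derivative_at by metis
  have "snd (tangent_of M c x y) c = y"
    by (simp add: tangent_of_def cp id)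
  then have "snd (tangent_of M c x y) \<noteq> (\<lambda>c. 0)" if "y \<noteq> 0"
    using that by auto
  moreover have "snd (tangent_of M c x 0) = (\<lambda>c. 0)"
  proof -
    have "frechet_derivative (transition c d) (at x) 0 = 0" if "d \<in> charts_at M (chart_inv c x)" for d
    proof -
      have "x \<in> chart_overlap c d" "d \<in> atlas M"
        using that x in_chart_overlap_iff[OF differentiable_atlasD(2)[OF M c]] by (auto simp: charts_at_def)
      then show ?thesis
        using linear_frechet_derivative[OF differentiable_atlasD(5)[OF M c]] linear_0 by blast
    qed
    then show ?thesis by (auto simp: tangent_of_def)
  qed
  ultimately show ?thesis
    using tangent_of_in_tangent_bundle[OF M c x] by (auto simp: slit_tangent_bundle_def)
qed

text \<open>\<open>tangent_map\<close> computes in a chart picked by choice; the chain rule carries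
  the result over to the given chart \<open>c\<close>.\<close>

lemma tangent_map_tangent_of:
  assumes M: "differentiable_atlas M" and c: "c \<in> atlas M" and x: "x \<in> chart_image c"
    and h: "\<And>d e. d \<in> charts_at M (chart_inv c x) \<Longrightarrow> e \<in> charts_at N (h (chart_inv c x)) \<Longrightarrow>
      (snd e \<circ> h \<circ> chart_inv d) differentiable (at (snd d (chart_inv c x)))"
  shows "tangent_map M N h (tangent_of M c x y) = (h (chart_inv c x),
    \<lambda>e. if e \<in> charts_at N (h (chart_inv c x)) then frechet_derivative (snd e \<circ> h \<circ> chart_inv c) (at x) y else 0)"
proof -
  note ci = chart_inv_props[OF differentiable_atlasD(2)[OF M c]]
  define d where "d = (SOME c'. c' \<in> charts_at M (chart_inv c x))"
  have "c \<in> charts_at M (chart_inv c x)" using c ci(2)[OF x] by (simp add: charts_at_def)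
  then have d: "d \<in> charts_at M (chart_inv c x)" unfolding d_def by (rule someI)
  then have o: "x \<in> chart_overlap c d"
    using x in_chart_overlap_iff[OF differentiable_atlasD(2)[OF M c]] by (auto simp: charts_at_def)
  have "frechet_derivative (snd e \<circ> h \<circ> chart_inv d) (at (snd d (chart_inv c x))) (frechet_derivative (transition c d) (at x) y) =
      frechet_derivative (snd e \<circ> h \<circ> chart_inv c) (at x) y" if "e \<in> charts_at N (h (chart_inv c x))" for e
    using frechet_derivative_chart_compose[OF M c charts_atD(1)[OF d] o, of "snd e \<circ> h" y] h[OF d that]
    by (simp add: transition_def)
  then show ?thesis
    using d by (auto simp: tangent_map_def tangent_of_def Let_def d_def[symmetric])
qed

context
  fixes M :: "('a, 'm::finite) mfd" and N :: "('b, 'n::finite) mfd"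
  assumes M: "differentiable_atlas M" and N: "differentiable_atlas N"
begin

lemma has_derivative_fst_chart:
  assumes c: "c \<in> atlas M" "d \<in> atlas N" and z: "z \<in> chart_image (prod_chart c d)"
    and e: "e \<in> charts_at M (chart_inv c (sub_vec Inl z))"
  shows "(snd e \<circ> fst \<circ> chart_inv (prod_chart c d) has_derivative
    (\<lambda>v. frechet_derivative (transition c e) (at (sub_vec Inl z)) (sub_vec Inl v))) (at z)"
proof (rule has_derivative_transform_within_open)
  have "sub_vec Inl z \<in> chart_overlap c e"
    using z e in_chart_overlap_iff[OF differentiable_atlasD(2)[OF M c(1)]]
    by (auto simp: charts_at_def chart_image_prod_chart)
  then show "((\<lambda>z. transition c e (sub_vec Inl z)) has_derivative
      (\<lambda>v. frechet_derivative (transition c e) (at (sub_vec Inl z)) (sub_vec Inl v))) (at z)"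
    using differentiable_atlasD(5)[OF M c(1) charts_atD(1)[OF e]]
    by (intro has_derivative_compose[OF bounded_linear_imp_has_derivative[OF bounded_linear_sub_vec]])
      (simp add: frechet_derivative_works[symmetric])
  show "open (chart_image (prod_chart c d))"
    by (rule differentiable_atlasD(3)[OF differentiable_atlas_prod_mfd[OF M N] prod_chart_in_atlas[OF c]])
  show "transition c e (sub_vec Inl z) = (snd e \<circ> fst \<circ> chart_inv (prod_chart c d)) z"
    if "z \<in> chart_image (prod_chart c d)" for z
    using that c by (simp add: transition_def chart_inv_prod_chart differentiable_atlasD(2)[OF M] differentiable_atlasD(2)[OF N])
qed (rule z)

lemma has_derivative_snd_chart:
  assumes c: "c \<in> atlas M" "d \<in> atlas N" and z: "z \<in> chart_image (prod_chart c d)"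
    and e: "e \<in> charts_at N (chart_inv d (sub_vec Inr z))"
  shows "(snd e \<circ> snd \<circ> chart_inv (prod_chart c d) has_derivative
    (\<lambda>v. frechet_derivative (transition d e) (at (sub_vec Inr z)) (sub_vec Inr v))) (at z)"
proof (rule has_derivative_transform_within_open)
  have "sub_vec Inr z \<in> chart_overlap d e"
    using z e in_chart_overlap_iff[OF differentiable_atlasD(2)[OF N c(2)]]
    by (auto simp: charts_at_def chart_image_prod_chart)
  then show "((\<lambda>z. transition d e (sub_vec Inr z)) has_derivative
      (\<lambda>v. frechet_derivative (transition d e) (at (sub_vec Inr z)) (sub_vec Inr v))) (at z)"
    using differentiable_atlasD(5)[OF N c(2) charts_atD(1)[OF e]]
    by (intro has_derivative_compose[OF bounded_linear_imp_has_derivative[OF bounded_linear_sub_vec]])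
      (simp add: frechet_derivative_works[symmetric])
  show "open (chart_image (prod_chart c d))"
    by (rule differentiable_atlasD(3)[OF differentiable_atlas_prod_mfd[OF M N] prod_chart_in_atlas[OF c]])
  show "transition d e (sub_vec Inr z) = (snd e \<circ> snd \<circ> chart_inv (prod_chart c d)) z"
    if "z \<in> chart_image (prod_chart c d)" for z
    using that c by (simp add: transition_def chart_inv_prod_chart differentiable_atlasD(2)[OF M] differentiable_atlasD(2)[OF N])
qed (rule z)

lemma
  assumes c: "c \<in> atlas M" "d \<in> atlas N" and z: "z \<in> chart_image (prod_chart c d)"
  shows tangent_map_fst: "tangent_map (prod_mfd M N) M fst (tangent_of (prod_mfd M N) (prod_chart c d) z w) =
      tangent_of M c (sub_vec Inl z) (sub_vec Inl w)"
    and tangent_map_snd: "tangent_map (prod_mfd M N) N snd (tangent_of (prod_mfd M N) (prod_chart c d) z w) =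
      tangent_of N d (sub_vec Inr z) (sub_vec Inr w)"
proof -
  note P = differentiable_atlas_prod_mfd[OF M N]
  note C = prod_chart_in_atlas[OF c]
  have ci: "chart_inv (prod_chart c d) z = (chart_inv c (sub_vec Inl z), chart_inv d (sub_vec Inr z))"
    using chart_inv_prod_chart[OF differentiable_atlasD(2)[OF M c(1)] differentiable_atlasD(2)[OF N c(2)] z] .
  \<comment> \<open>The atlas of the product contains product charts only, so the unknown chart
    chosen in \<open>tangent_map\<close> also splits, and differentiability reduces to the
    factors.\<close>
  have other: "\<exists>c' d'. C' = prod_chart c' d' \<and> c' \<in> atlas M \<and> d' \<in> atlas N \<and>
      snd C' (chart_inv (prod_chart c d) z) \<in> chart_image C' \<and>
      chart_inv c' (sub_vec Inl (snd C' (chart_inv (prod_chart c d) z))) = chart_inv c (sub_vec Inl z) \<and>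
      chart_inv d' (sub_vec Inr (snd C' (chart_inv (prod_chart c d) z))) = chart_inv d (sub_vec Inr z)"
    if C'0: "C' \<in> charts_at (prod_mfd M N) (chart_inv (prod_chart c d) z)" for C'
  proof -
    obtain c' d' where C': "C' = prod_chart c' d'" "c' \<in> atlas M" "d' \<in> atlas N"
      using charts_atD(1)[OF C'0] unfolding prod_mfd_def mfd.simps by blast
    moreover have "chart_inv (prod_chart c d) z \<in> fst c' \<times> fst d'"
      using charts_atD(2)[OF C'0] unfolding C'(1) fst_prod_chart .
    ultimately show ?thesis
      using chart_inv_props(1)[OF differentiable_atlasD(2)[OF M C'(2)]]
        chart_inv_props(1)[OF differentiable_atlasD(2)[OF N C'(3)]]
      by (intro exI[of _ c'] exI[of _ d']) (auto simp: ci snd_prod_chart chart_image_prod_chart, auto simp: chart_image_def)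
  qed
  have "(snd e \<circ> fst \<circ> chart_inv C') differentiable (at (snd C' (chart_inv (prod_chart c d) z)))"
    if "C' \<in> charts_at (prod_mfd M N) (chart_inv (prod_chart c d) z)"
      "e \<in> charts_at M (fst (chart_inv (prod_chart c d) z))" for C' e
    using other[OF that(1)] that(2) has_derivative_fst_chart unfolding differentiable_def ci fst_conv by metis
  from tangent_map_tangent_of[OF P C z this, of M]
  show "tangent_map (prod_mfd M N) M fst (tangent_of (prod_mfd M N) (prod_chart c d) z w) =
      tangent_of M c (sub_vec Inl z) (sub_vec Inl w)"
    using frechet_derivative_at[OF has_derivative_fst_chart[OF c z], symmetric]
    by (auto simp: tangent_of_def ci)
  have "(snd e \<circ> snd \<circ> chart_inv C') differentiable (at (snd C' (chart_inv (prod_chart c d) z)))"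
    if "C' \<in> charts_at (prod_mfd M N) (chart_inv (prod_chart c d) z)"
      "e \<in> charts_at N (snd (chart_inv (prod_chart c d) z))" for C' e
    using other[OF that(1)] that(2) has_derivative_snd_chart unfolding differentiable_def ci snd_conv by metis
  from tangent_map_tangent_of[OF P C z this, of N]
  show "tangent_map (prod_mfd M N) N snd (tangent_of (prod_mfd M N) (prod_chart c d) z w) =
      tangent_of N d (sub_vec Inr z) (sub_vec Inr w)"
    using frechet_derivative_at[OF has_derivative_snd_chart[OF c z], symmetric]
    by (auto simp: tangent_of_def ci)
qed

text \<open>The bridge from the invariant warped metric to the coordinate energy: both differentials
  of the projections are coordinate projections in a product chart.\<close>

lemma
  assumes c: "c \<in> atlas M" "d \<in> atlas N" and z: "z \<in> chart_image (prod_chart c d)"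
  shows tangent_of_in_warped_domain: "sub_vec Inl w \<noteq> 0 \<Longrightarrow> sub_vec Inr w \<noteq> 0 \<Longrightarrow>
      tangent_of (prod_mfd M N) (prod_chart c d) z w \<in> warped_domain M N"
    and local_rep_warped_metric: "(local_rep (prod_mfd M N) (warped_metric M F1 N F2 f) (prod_chart c d) z w)\<^sup>2 =
      (local_rep M F1 c (sub_vec Inl z) (sub_vec Inl w))\<^sup>2 +
      (f (chart_inv c (sub_vec Inl z)))\<^sup>2 * (local_rep N F2 d (sub_vec Inr z) (sub_vec Inr w))\<^sup>2"
proof -
  note C = prod_chart_in_atlas[OF c]
  have zc: "sub_vec Inl z \<in> chart_image c" "sub_vec Inr z \<in> chart_image d"
    using z by (auto simp: chart_image_prod_chart)
  show "sub_vec Inl w \<noteq> 0 \<Longrightarrow> sub_vec Inr w \<noteq> 0 \<Longrightarrow>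
      tangent_of (prod_mfd M N) (prod_chart c d) z w \<in> warped_domain M N"
    using tangent_of_in_tangent_bundle[OF differentiable_atlas_prod_mfd[OF M N] C z]
      tangent_of_in_slit_tangent_bundle_iff[OF M c(1) zc(1)] tangent_of_in_slit_tangent_bundle_iff[OF N c(2) zc(2)]
    by (simp add: warped_domain_def tangent_map_fst[OF c z] tangent_map_snd[OF c z])
  have "fst (fst (tangent_of (prod_mfd M N) (prod_chart c d) z w)) = chart_inv c (sub_vec Inl z)"
    using chart_inv_prod_chart[OF differentiable_atlasD(2)[OF M c(1)] differentiable_atlasD(2)[OF N c(2)] z]
    by (simp add: tangent_of_def)
  then show "(local_rep (prod_mfd M N) (warped_metric M F1 N F2 f) (prod_chart c d) z w)\<^sup>2 =
      (local_rep M F1 c (sub_vec Inl z) (sub_vec Inl w))\<^sup>2 +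
      (f (chart_inv c (sub_vec Inl z)))\<^sup>2 * (local_rep N F2 d (sub_vec Inr z) (sub_vec Inr w))\<^sup>2"
    by (simp add: local_rep_def warped_metric_def tangent_map_fst[OF c z] tangent_map_snd[OF c z])
qed

end

text \<open>Smoothness in coordinates gives continuity on each chart domain; these domains are open
  and cover the space, so \<open>f\<close> is continuous on it and compactness applies.\<close>

lemma smooth_function_attains_min:
  assumes "smooth_manifold M" "compact_space (mtop M)" "smooth_function M f" "topspace (mtop M) \<noteq> {}"
  shows "\<exists>p\<in>topspace (mtop M). \<forall>q\<in>topspace (mtop M). f p \<le> f q"
proof -
  have chart: "openin (mtop M) (fst c)"
    "homeomorphic_map (subtopology (mtop M) (fst c)) (top_of_set (chart_image c)) (snd c)"
    "inj_on (snd c) (fst c)" "fst c \<subseteq> topspace (mtop M)" if "c \<in> atlas M" for c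
    using assms(1) that differentiable_atlasD[OF smooth_manifold_imp_differentiable_atlas[OF assms(1)] that]
    by (auto simp: smooth_manifold_def)
  have cont: "continuous_map (subtopology (mtop M) (fst c)) euclideanreal f" if c: "c \<in> atlas M" for c
  proof (rule continuous_map_eq)
    have "continuous_on (chart_image c) (f \<circ> chart_inv c)"
      using assms(3) c smooth_on_imp_continuous_on unfolding smooth_function_def by blast
    then show "continuous_map (subtopology (mtop M) (fst c)) euclideanreal ((f \<circ> chart_inv c) \<circ> snd c)"
      by (intro continuous_map_compose[OF homeomorphic_imp_continuous_map[OF chart(2)[OF c]]])
        (simp only: continuous_map_iff_continuous)
    show "((f \<circ> chart_inv c) \<circ> snd c) p = f p" if "p \<in> topspace (subtopology (mtop M) (fst c))" for p
      using that chart_inv_props(1)[OF chart(3)[OF c]] by (simp add: topspace_subtopology)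
  qed
  have "continuous_map (mtop M) euclideanreal f"
    unfolding continuous_map_def
  proof (intro conjI allI impI)
    fix S :: "real set" assume S: "openin euclideanreal S"
    show "openin (mtop M) {p \<in> topspace (mtop M). f p \<in> S}"
    proof (subst openin_subopen, intro ballI)
      fix p assume p: "p \<in> {p \<in> topspace (mtop M). f p \<in> S}"
      then obtain c where c: "c \<in> atlas M" "p \<in> fst c"
        using assms(1) by (fastforce simp: smooth_manifold_def charts_at_def)
      have "openin (subtopology (mtop M) (fst c)) {q \<in> topspace (subtopology (mtop M) (fst c)). f q \<in> S}"
        using cont[OF c(1)] S unfolding continuous_map_def by blast
      then have "openin (mtop M) {q \<in> topspace (subtopology (mtop M) (fst c)). f q \<in> S}"
        using chart(1)[OF c(1)] openin_trans_full by blast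
      then show "\<exists>T. openin (mtop M) T \<and> p \<in> T \<and> T \<subseteq> {p \<in> topspace (mtop M). f p \<in> S}"
        using c p by (intro exI[of _ "{q \<in> topspace (subtopology (mtop M) (fst c)). f q \<in> S}"])
          (auto simp: topspace_subtopology)
    qed
  qed auto
  then have "compact (f ` topspace (mtop M))"
    using image_compactin assms(2) by (fastforce simp: compact_space_def)
  then show ?thesis
    using compact_attains_inf[of "f ` topspace (mtop M)"] assms(4) by auto
qed

lemma pos_def_invertible:
  fixes Q :: "real^'n::finite^'n"
  assumes "\<And>v. v \<noteq> 0 \<Longrightarrow> 0 < (\<Sum>i\<in>UNIV. \<Sum>j\<in>UNIV. Q $ i $ j * v $ i * v $ j)"
  shows "invertible Q"
proof -
  have "v = 0" if "Q *v v = 0" for v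
  proof (rule ccontr)
    assume "v \<noteq> 0"
    have "(\<Sum>i\<in>UNIV. \<Sum>j\<in>UNIV. Q $ i $ j * v $ i * v $ j) = (\<Sum>i\<in>UNIV. v $ i * (Q *v v) $ i)"
      by (simp add: matrix_vector_mult_def sum_distrib_left algebra_simps)
    with assms[OF \<open>v \<noteq> 0\<close>] that show False by simp
  qed
  then show ?thesis
    by (simp add: invertible_left_inverse matrix_left_invertible_ker)
qed

section \<open>The Ricci scalar of the fiber\<close>

lemma bilinear_expand_axis:
  fixes B :: "real^'n::finite \<Rightarrow> real^'n \<Rightarrow> real"
  assumes "bilinear B"
  shows "B u v = (\<Sum>i\<in>UNIV. \<Sum>j\<in>UNIV. B (axis i 1) (axis j 1) * (u $ i * v $ j))"
proof -
  have "B u v = (\<Sum>i\<in>UNIV. u $ i * B (axis i 1) v)"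
    using assms by (intro linear_expand_axis[of "\<lambda>u. B u v"]) (simp add: bilinear_def)
  also have "\<dots> = (\<Sum>i\<in>UNIV. u $ i * (\<Sum>j\<in>UNIV. v $ j * B (axis i 1) (axis j 1)))"
    using assms by (subst linear_expand_axis[of "B (axis _ 1)" v]) (simp_all add: bilinear_def)
  finally show ?thesis by (simp add: sum_distrib_left algebra_simps)
qed

theorem corollary6p1:
  fixes M1 :: "('a, 'm::finite) mfd" and M2 :: "('b, 'n::finite) mfd"
    and g1 :: "('a, 'm) tvec \<Rightarrow> ('a, 'm) tvec \<Rightarrow> real"
    and F2 :: "('b, 'n) tvec \<Rightarrow> real"
    and f :: "'a \<Rightarrow> real" and lam :: "'a \<times> 'b \<Rightarrow> real"
  assumes "smooth_manifold M1" and "compact_space (mtop M1)" and "riemannian_metric M1 g1"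
    and "smooth_manifold M2" and "finsler_metric M2 F2" and "weakly_berwald M2 F2"
    and "CARD('m) \<ge> 2" and "CARD('n) \<ge> 2"
    and "smooth_function M1 f" and "\<forall>p\<in>topspace (mtop M1). f p > 0"
    and "einstein_on (prod_mfd M1 M2) (warped_domain M1 M2)
           (warped_metric M1 (metric_norm g1) M2 F2 f) lam"
    and "\<forall>p\<in>topspace (mtop (prod_mfd M1 M2)). lam p > 0"
    and "\<not> trivial_warping M1 f"
  shows "(\<exists>\<mu>. einstein_on M2 (slit_tangent_bundle M2) F2 \<mu>) \<and>
         (\<forall>\<mu>. einstein_on M2 (slit_tangent_bundle M2) F2 \<mu> \<longrightarrow>
              (\<forall>q\<in>topspace (mtop M2). \<mu> q > 0))"
proof -
  note M1 = smooth_manifold_imp_differentiable_atlas[OF assms(1)]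
    and M2 = smooth_manifold_imp_differentiable_atlas[OF assms(4)]
  \<comment> \<open>On an empty base every function would count as constant, so nontriviality
    supplies a point.\<close>
  have "topspace (mtop M1) \<noteq> {}"
    using assms(13) by (auto simp: trivial_warping_def)
  then obtain p where p: "p \<in> topspace (mtop M1)" and p_min: "\<And>q. q \<in> topspace (mtop M1) \<Longrightarrow> f p \<le> f q"
    using smooth_function_attains_min[OF assms(1,2,9)] by blast
  obtain c where c: "c \<in> atlas M1" "p \<in> fst c"
    using assms(1) p by (fastforce simp: smooth_manifold_def charts_at_def)
  note ca = differentiable_atlasD[OF M1 c(1)]
  define x0 where "x0 = snd c p"
  have x0: "x0 \<in> chart_image c" "chart_inv c x0 = p"
    using c chart_inv_props(1)[OF ca(2)] by (auto simp: x0_def chart_image_def)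
  have top: "chart_inv c x \<in> topspace (mtop M1)" if "x \<in> chart_image c" for x
    using chart_inv_props(2)[OF ca(2) that] ca(1) by auto
  define B where "B x u v = g1 (tangent_of M1 c x u) (tangent_of M1 c x v)" for x u v
  have B: "bilinear (B x)" "B x u v = B x v u" "u \<noteq> 0 \<Longrightarrow> B x u u > 0"
    if "x \<in> chart_image c" for x u v
    using assms(3) c(1) that by (auto simp: riemannian_metric_def Let_def B_def[abs_def])
  define b :: "real^'m \<Rightarrow> real^'m^'m" where "b x = (\<chi> i j. B x (axis i 1) (axis j 1))" for x
  have b: "smooth_on (\<lambda>x. b x $ i $ j) (chart_image c)" for i j
    using assms(3) c(1) by (auto simp: riemannian_metric_def Let_def b_def B_def)
  have Bb: "B x u u = (\<Sum>i\<in>UNIV. \<Sum>j\<in>UNIV. b x $ i $ j * (u $ i * u $ j))" if "x \<in> chart_image c" for x u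
    by (subst bilinear_expand_axis[OF B(1)[OF that]]) (simp add: b_def)
  have B_nonneg: "B x u u \<ge> 0" if "x \<in> chart_image c" for x u
    using B(3)[OF that, of u] Bb[OF that, of u] by (cases "u = 0") auto
  define F where "F x = (f (chart_inv c x))\<^sup>2" for x
  have F: "smooth_on F (chart_image c)"
    using assms(9) c(1) smooth_on_mult[OF ca(3), of "f \<circ> chart_inv c" "f \<circ> chart_inv c"]
    by (simp add: F_def[abs_def] power2_eq_square smooth_function_def)
  have F_pos: "F x > 0" if "x \<in> chart_image c" for x
    using bspec[OF assms(10) top[OF that]] by (simp add: F_def)
  \<comment> \<open>Squaring is monotone on positive values, so the minimum of \<open>f\<close> is
    also one of \<open>F\<close>; it is global, hence a minimum on the whole chart.\<close>
  have F_min: "F x0 \<le> F x" if "x \<in> chart_image c" for x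
    using p_min[OF top[OF that]] bspec[OF assms(10) p] by (simp add: F_def x0 power_mono)
  have F_crit: "dx l (\<lambda>x y. F x) x0 0 = 0" for l
    unfolding dx_def by (subst frechet_derivative_min[OF ca(3) x0(1) F F_min]) auto

  define L2 where "L2 d = local_rep M2 F2 d" for d
  have fin: "smooth_on (\<lambda>(x, y). L2 d x y) (chart_image d \<times> (UNIV - {0}))"
      "x \<in> chart_image d \<Longrightarrow> t > 0 \<Longrightarrow> L2 d x (t *\<^sub>R y) = t * L2 d x y"
      "x \<in> chart_image d \<Longrightarrow> y \<noteq> 0 \<Longrightarrow> w \<noteq> 0 \<Longrightarrow>
        0 < (\<Sum>i\<in>UNIV. \<Sum>j\<in>UNIV. fundamental_tensor (L2 d) i j x y * w $ i * w $ j)"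
    if "d \<in> atlas M2" for d x y w and t :: real
    using assms(5) that by (auto simp: finsler_metric_def Let_def L2_def)
  define E2 where "E2 d x y = (L2 d x y)\<^sup>2" for d x y
  have E2: "smooth2 (chart_image d \<times> (UNIV - {0})) (E2 d)" if d: "d \<in> atlas M2" for d
  proof -
    have op: "open (chart_image d \<times> (UNIV - {0 :: real^'n}))"
      using differentiable_atlasD(3)[OF M2 d] by (auto intro: open_Times)
    have "smooth2 (chart_image d \<times> (UNIV - {0})) (L2 d)"
      using fin(1)[OF d] by (simp add: smooth2_def case_prod_beta')
    from smooth2_mult[OF op this this] show ?thesis
      by (simp add: E2_def[abs_def] power2_eq_square)
  qed
  \<comment> \<open>\<open>A\<close> is built from base data alone, so one function serves all
    charts of the fiber.\<close>
  define \<mu> where "\<mu> q = lam (p, q) * F x0 + warped_energy.A b F x0" for q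

  have warped: "warped_energy (chart_image c) (chart_image d) b F (E2 d)" if d: "d \<in> atlas M2" for d
  proof
    show "open (chart_image c)" "open (chart_image d)"
      using ca(3) differentiable_atlasD(3)[OF M2 d] by auto
    show "b x $ i $ j = b x $ j $ i" if "x \<in> chart_image c" for x i j
      using B(2)[OF that] by (simp add: b_def)
    show "invertible (b x)" if "x \<in> chart_image c" for x
      by (rule pos_def_invertible) (use Bb[OF that] B(3)[OF that] in \<open>simp add: mult.assoc\<close>)
    show "homogeneous (chart_image d \<times> (UNIV - {0})) 2 (E2 d)"
      using fin(2)[OF d] by (simp add: homogeneous_def E2_def power_mult_distrib)
    show "invertible (\<chi> i j. energy_tensor (E2 d) i j x y)" if "x \<in> chart_image d" "y \<noteq> 0" for x y
      by (rule pos_def_invertible)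
        (use fin(3)[OF d that] in \<open>simp add: E2_def[abs_def] flip: fundamental_tensor_eq\<close>)
  qed (use b F F_pos E2[OF d] in auto)

  have Ric2: "Ric (L2 d) x y = \<mu> (chart_inv d x) * E2 d x y"
    if d: "d \<in> atlas M2" and x: "x \<in> chart_image d" and y: "y \<noteq> 0" for d x y
  proof -
    interpret warped_energy "chart_image c" "chart_image d" b F "E2 d" by (rule warped[OF d])
    let ?C = "prod_chart c d" and ?P = "prod_mfd M1 M2"
    let ?L = "local_rep ?P (warped_metric M1 (metric_norm g1) M2 F2 f) ?C"
    \<comment> \<open>Proved on all of \<open>W\<close>, not just over \<open>x0\<close>, since the
      spray and its curvature differentiate this identity.\<close>
    have L: "(?L z w)\<^sup>2 = E z w" if "(z, w) \<in> W" for z w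
    proof -
      have z: "sub_vec Inl z \<in> chart_image c" "z \<in> chart_image ?C"
        using that by (auto simp: W_def chart_image_prod_chart)
      have "(local_rep M1 (metric_norm g1) c (sub_vec Inl z) u)\<^sup>2 = B (sub_vec Inl z) u u" for u
        using B_nonneg[OF z(1)] by (simp add: local_rep_def metric_norm_def B_def)
      then show ?thesis
        by (simp add: local_rep_warped_metric[OF M1 M2 c(1) d z(2)] E_def E1_def pullback_def
            Bb[OF z(1)] F_def E2_def L2_def)
    qed
    have "spray_ricci (energy_spray (E2 d)) x y = (lam (p, chart_inv d x) * F x0 + A x0) * E2 d x y"
    proof (rule einstein_fibre[OF x0(1) F_crit x _ y])
      fix y1 :: "real^'m" and y2 :: "real^'n" assume y12: "y1 \<noteq> 0" "y2 \<noteq> 0"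
      let ?z = "vec_join x0 x" and ?w = "vec_join y1 y2"
      have zw: "(?z, ?w) \<in> W" and z: "?z \<in> chart_image ?C"
        using x0 x y12 by (auto simp: W_def chart_image_prod_chart)
      have "smooth2 W (energy_spray E i)" for i
        by (rule smooth2_cong[OF open_W smooth_G]) (simp add: energy_spray_eq_G)
      then have "spray_ricci (energy_spray E) ?z ?w = Ric ?L ?z ?w"
        unfolding Ric_eq
        by (intro spray_ricci_cong[OF open_W _ _ zw, symmetric] energy_spray_cong[OF open_W smooth_E L])
      also have "\<dots> = lam (chart_inv ?C ?z) * (?L ?z ?w)\<^sup>2"
        using assms(11) prod_chart_in_atlas[OF c(1) d] z tangent_of_in_warped_domain[OF M1 M2 c(1) d z] y12
        by (simp add: einstein_on_def Let_def)
      also have "chart_inv ?C ?z = (p, chart_inv d x)"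
        using chart_inv_prod_chart[OF ca(2) differentiable_atlasD(2)[OF M2 d] z] by (simp add: x0)
      finally show "spray_ricci (energy_spray E) ?z ?w = lam (p, chart_inv d x) * E ?z ?w"
        by (simp add: L[OF zw])
    qed
    then show ?thesis by (simp add: Ric_eq \<mu>_def E2_def[abs_def])
  qed

  have Ric_tensor2: "Ric_tensor (L2 d) i j x y = \<mu> (chart_inv d x) * fundamental_tensor (L2 d) i j x y"
    if d: "d \<in> atlas M2" and x: "x \<in> chart_image d" and y: "y \<noteq> 0" for d x y i j
  proof -
    let ?m = "\<mu> (chart_inv d x)"
    have opW: "open (chart_image d \<times> (UNIV - {0 :: real^'n}))"
      using differentiable_atlasD(3)[OF M2 d] by (auto intro: open_Times)
    have op: "open (UNIV - {0 :: real^'n})" by auto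
    \<comment> \<open>At a fixed position the Ricci scalar is a constant factor and commutes with
      velocity derivatives. Two applications lead from the Ricci curvature to the Ricci
      tensor.\<close>
    have scale: "dy k h x y = ?m * dy k h' x y"
      if "smooth2 (chart_image d \<times> (UNIV - {0})) h'" "\<And>y. y \<noteq> 0 \<Longrightarrow> h x y = ?m * h' x y" "y \<noteq> 0" for k h h' y
    proof -
      have diff: "h' x differentiable (at y)"
        using smooth2_diff_snd[OF that(1)] x that(3) by auto
      then have "frechet_derivative (\<lambda>y. ?m * h' x y) (at y) = frechet_derivative (h x) (at y)"
        using that by (intro frechet_derivative_transform_within_open[OF _ op]) auto
      then show ?thesis
        using frechet_derivative_mult_real[of "\<lambda>y. ?m" y "h' x" "axis k 1"] diff by (simp add: dy_def)
    qed
    have "dy j (Ric (L2 d)) x y = ?m * dy j (E2 d) x y" if "y \<noteq> 0" for y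
      using E2[OF d] Ric2[OF d x] that by (rule scale)
    with smooth2_dy[OF opW E2[OF d]]
    have "dy i (dy j (Ric (L2 d))) x y = ?m * dy i (dy j (E2 d)) x y"
      using y by (rule scale)
    then show ?thesis
      by (simp add: Ric_tensor_def fundamental_tensor_def E2_def[abs_def])
  qed

  have "einstein_on M2 (slit_tangent_bundle M2) F2 \<mu>"
    unfolding einstein_on_def Let_def
    using Ric2 Ric_tensor2 tangent_of_in_slit_tangent_bundle_iff[OF M2] by (simp add: L2_def E2_def)
  moreover have "\<mu>' q > 0"
    if ein: "einstein_on M2 (slit_tangent_bundle M2) F2 \<mu>'" and q: "q \<in> topspace (mtop M2)" for \<mu>' q
  proof -
    obtain d where d: "d \<in> atlas M2" "q \<in> fst d"
      using assms(4) q by (fastforce simp: smooth_manifold_def charts_at_def)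
    define x where "x = snd d q"
    have x: "x \<in> chart_image d" "chart_inv d x = q"
      using d chart_inv_props(1)[OF differentiable_atlasD(2)[OF M2 d(1)]] by (auto simp: x_def chart_image_def)
    define y :: "real^'n" where "y = axis undefined 1"
    have y: "y \<noteq> 0" by (simp add: y_def axis_eq_0_iff)
    \<comment> \<open>Uniqueness of the Ricci scalar: contracting both Einstein equations with a
      nonzero \<open>y\<close> leaves a common positive factor, which cancels.\<close>
    have "\<mu>' q * fundamental_tensor (L2 d) i j x y = \<mu> q * fundamental_tensor (L2 d) i j x y" for i j
      using ein d(1) x y tangent_of_in_slit_tangent_bundle_iff[OF M2 d(1) x(1)] Ric_tensor2[OF d(1) x(1) y]
      by (auto simp: einstein_on_def Let_def L2_def)
    then have "\<mu>' q * (\<Sum>i\<in>UNIV. \<Sum>j\<in>UNIV. fundamental_tensor (L2 d) i j x y * y $ i * y $ j) =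
        \<mu> q * (\<Sum>i\<in>UNIV. \<Sum>j\<in>UNIV. fundamental_tensor (L2 d) i j x y * y $ i * y $ j)"
      by (simp only: sum_distrib_left mult.assoc[symmetric])
    with fin(3)[OF d(1) x(1) y y] have "\<mu>' q = \<mu> q" by simp
    moreover have "lam (p, q) > 0"
      using assms(12) p q by (simp add: prod_mfd_def)
    moreover have "warped_energy.A b F x0 \<ge> 0"
      using warped_energy.A_nonneg[OF warped[OF d(1)] x0(1) F_min] B_nonneg[OF x0(1)] Bb[OF x0(1)] by simp
    ultimately show ?thesis
      using F_pos[OF x0(1)] by (simp add: \<mu>_def add_pos_nonneg)
  qed
  ultimately show ?thesis by blast
qed

end
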